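(* Let $r\ge1$. If vectors $\mathbf m=(m_1,\dots,m_r)$, $\mathbf m'=(m_1',\dots,m_r')$ and $\mathbf C=(C_1,\dots,C_r)$ in $(\mathfrak o_S\setminus\{0\})^r$ satisfy $\gcd(m_1'\cdots m_r',\,C_1\cdots C_r)=1$, then $$H(\mathbf C;m_1m_1',\dots,m_rm_r')=\prod_{i=1}^r\left(\frac{m_i'}{C_i}\right)_n^{-\varepsilon_i}H(\mathbf C;\mathbf m).$$
   Context: Fix $n\ge1$ and a number field $F$ whose group of $4n$-th roots of unity has order $4n$. $S$ is a finite set of places of $F$ containing all archimedean places and all places ramified over $\mathbb Q$ (in particular those dividing $n$), large enough that the ring $\mathfrak o_S$ of $S$-integers is a principal ideal domain and the residue field at every $v\notin S$ has at least 4 elements. $F_S=\prod_{v\in S}F_v$. $(\ ,\ )_S$ is the product over $v\in S$ of the $2n$-th order local Hilbert symbols, $\left(\frac cd\right)_m$ ($m\mid 2n$) the $m$-th power residue symbol, normalized so that $\left(\frac cd\right)_{2n}=(d,c)_S\left(\frac dc\right)_{2n}$. $\psi$ is an additive character of $F_S$ with conductor exactly $\mathfrak o_S$. $|C|=\#(\mathfrak o_S/C\mathfrak o_S)$. In rank $r$, $\varepsilon_i=1$ for $1\le i\le r-1$ and $\varepsilon_r=2$. The coefficients $H(C_1,\dots,C_r;m_1,\dots,m_r)$ ($C_i,m_i\in\mathfrak o_S\setminus\{0\}$) are defined by induction on $r$. For $r=1$, $H(C_1;m_1)=\sum_{c\bmod C_1,(c,C_1)=1}\left(\frac{c}{C_1}\right)_n^2\psi\left(\frac{m_1c}{C_1}\right)$.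 For $r\ge2$, \begin{align*} &H(C_{1},\dots,C_{r};m_{1},\dots,m_{r})=\sum_{D_i,\,d_i}\ \sum_{\substack{c_{i}\bmod{d_{i}}\\(c_i,d_i)=1}}\ \prod_{k=1}^r \left(\frac{c_k}{d_k}\right)_n\left(\frac{c_{2r-k}}{d_{2r-k}}\right)_n\cdot\prod^{r-1}_{i=1}\prod^{2r-1}_{j=2r-i}(d_{2r-i}/d_{i},d_{j})_{S}\cdot \prod^{r}_{i=2}(\mathfrak d_{i-1}/\mathfrak d_{i},D_{i})^{-\varepsilon_{i}}_{S}\\ &\times\psi\left(m_{1}\frac{c_{1}}{d_{1}}+\sum_{j=1}^{r-1} m_{j+1}\left(\frac{u_{j}c_{j+1}}{d_{j+1}}+(-1)^{\varepsilon_{j+1}}\frac{d_{j}c_{2r-j}u_{2r-1-j}}{d_{j+1}d_{2r-j}}\right)\right)|d_{r}|^{2r-2}\prod_{j=1}^{r-1} \left|d^{\,j-1}_{j}d^{\,r+j-2}_{r+j}\right|\\ &\times H\left(D_{2},\dots,D_{r};\frac{m_{2}d_{1}d_{2r-2}}{d_{2}d_{2r-1}},\dots,\frac{m_{r-1}d_{r-2}d_{r+1}}{d_{r-1}d_{r+2}},\frac{m_{r}d_{r-1}}{d_{r+1}}\right), \end{align*} where the outer sum is over nonzero $D_i\in\mathfrak o_S/\mathfrak o_S^\times$ ($2\le i\le r$) and nonzero $d_i\in\mathfrak o_S/\mathfrak o_S^\times$ ($1\le i\le 2r-1$) such that, modulo units, $C_i=\mathfrak d_iD_i$ for $1\le i\le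 r$, with $D_1=1$, $\mathfrak d_1=d_1\cdots d_{r-1}d_r^2d_{r+1}\cdots d_{2r-1}$, $\mathfrak d_j=d_j\cdots d_{r-1}d_r^2d_{r+1}\cdots d_{2r-j}d_{2r-j+1}^2\cdots d_{2r-1}^2$ for $2\le j\le r-1$, $\mathfrak d_r=d_rd_{r+1}\cdots d_{2r-1}$, and such that in $\mathfrak o_S$: $d_{j+1}\mid m_{j+1}d_j$ for $1\le j\le r-1$; $d_{j+1}d_{2r-j}\mid m_{j+1}d_jd_{2r-j-1}$ for $1\le j\le r-2$; $d_{r+1}\mid m_rd_{r-1}$. The $u_i$ satisfy $c_iu_i\equiv1\bmod d_i$. *)

theory Defs
  imports "HOL-Analysis.Analysis" "HOL-Algebra.Algebra" "HOL-Algebra.Algebraic_Closure_Type"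
begin

section \<open>Places of a number field\<close>

text \<open>
  The number field is a type \<open>'a\<close> of characteristic zero. Its places are represented by nontrivial
  absolute values, taken up to equivalence. All notions below (completion as a topological ring,
  integrality, Hilbert symbol) depend only on the equivalence class.
\<close>

abbreviation type_ring :: "'a::field ring" where
  "type_ring \<equiv> ring_of_type_algebra"

definition number_field :: "'a::field_char_0 itself \<Rightarrow> bool" where
  "number_field _ \<longleftrightarrow>
     (\<exists>B::'a set. finite B \<and> module.span (\<lambda>(q::rat) x. of_rat q * x) B = UNIV)"

definition place :: "('a::field \<Rightarrow> real) \<Rightarrow> bool" where
  "place v \<longleftrightarrow> (\<forall>x. 0 \<le> v x) \<and> (\<forall>x. v x = 0 \<longleftrightarrow> x = 0) \<and> (\<forall>x y. v (x * y) = v x * v y)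
     \<and> (\<forall>x y. v (x + y) \<le> v x + v y) \<and> (\<exists>x. x \<noteq> 0 \<and> v x \<noteq> 1)"

definition same_place :: "('a \<Rightarrow> real) \<Rightarrow> ('a \<Rightarrow> real) \<Rightarrow> bool" where
  "same_place v w \<longleftrightarrow> (\<exists>s>0. \<forall>x. w x = v x powr s)"

definition nonarch :: "('k, 'b) ring_scheme \<Rightarrow> ('k \<Rightarrow> real) \<Rightarrow> bool" where
  "nonarch K v \<longleftrightarrow> (\<forall>x\<in>carrier K. \<forall>y\<in>carrier K. v (x \<oplus>\<^bsub>K\<^esub> y) \<le> max (v x) (v y))"

text \<open>Residue fields are finite, so a finite place is ramified over \<open>\<rat>\<close> iff the index of the value
  group of \<open>\<rat>\<close> in that of the field is not 1.\<close>

definition ramified_over_Q :: "('a::field_char_0 \<Rightarrow> real) \<Rightarrow> bool" where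
  "ramified_over_Q v \<longleftrightarrow> nonarch type_ring v \<and> v ` (UNIV - {0}) \<noteq> v ` (\<rat> - {0})"

definition val_ring :: "'k ring \<Rightarrow> ('k \<Rightarrow> real) \<Rightarrow> 'k ring" where
  "val_ring K v = K\<lparr>carrier := {x \<in> carrier K. v x \<le> 1}\<rparr>"

definition residue_card :: "'k ring \<Rightarrow> ('k \<Rightarrow> real) \<Rightarrow> nat" where
  "residue_card K v = card (carrier (val_ring K v Quot {x \<in> carrier K. v x < 1}))"

definition place_outside :: "('a::field \<Rightarrow> real) set \<Rightarrow> ('a \<Rightarrow> real) \<Rightarrow> bool" where
  "place_outside S v \<longleftrightarrow> place v \<and> (\<forall>w\<in>S. \<not> same_place v w)"

definition S_integers :: "('a::field \<Rightarrow> real) set \<Rightarrow> 'a set" where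
  "S_integers S = {x. \<forall>v. place_outside S v \<and> nonarch type_ring v \<longrightarrow> v x \<le> 1}"

definition S_ring :: "('a::field \<Rightarrow> real) set \<Rightarrow> 'a ring" (\<open>\<oo>\<close>) where
  "\<oo> S = type_ring\<lparr>carrier := S_integers S\<rparr>"

definition ideal_norm :: "('a::field \<Rightarrow> real) set \<Rightarrow> 'a \<Rightarrow> nat" where
  "ideal_norm S x = card (carrier (\<oo> S Quot PIdl\<^bsub>\<oo> S\<^esub> x))"


section \<open>Completions and additive characters\<close>

definition cauchy_ring :: "('a::field \<Rightarrow> real) \<Rightarrow> (nat \<Rightarrow> 'a) ring" where
  "cauchy_ring v = \<lparr>carrier = {s. \<forall>e>0. \<exists>N. \<forall>i\<ge>N. \<forall>j\<ge>N. v (s i - s j) < e},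
     monoid.mult = (\<lambda>s t i. s i * t i), one = (\<lambda>i. 1), ring.zero = (\<lambda>i. 0), add = (\<lambda>s t i. s i + t i)\<rparr>"

definition null_seqs :: "('a::field \<Rightarrow> real) \<Rightarrow> (nat \<Rightarrow> 'a) set" where
  "null_seqs v = {s. (\<lambda>i. v (s i)) \<longlonglongrightarrow> 0}"

definition completion :: "('a::field \<Rightarrow> real) \<Rightarrow> (nat \<Rightarrow> 'a) set ring" where
  "completion v = cauchy_ring v Quot null_seqs v"

definition to_completion :: "('a::field \<Rightarrow> real) \<Rightarrow> 'a \<Rightarrow> (nat \<Rightarrow> 'a) set" where
  "to_completion v x = null_seqs v +>\<^bsub>cauchy_ring v\<^esub> (\<lambda>_. x)"

definition completion_abs :: "('a::field \<Rightarrow> real) \<Rightarrow> (nat \<Rightarrow> 'a) set \<Rightarrow> real" where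
  "completion_abs v Z = lim (\<lambda>i. v ((SOME s. s \<in> Z) i))"

text \<open>The value 0 off the carrier makes this an instance of \<^locale>\<open>Metric_space\<close>.\<close>

definition completion_dist ::
    "('a::field \<Rightarrow> real) \<Rightarrow> (nat \<Rightarrow> 'a) set \<Rightarrow> (nat \<Rightarrow> 'a) set \<Rightarrow> real" where
  "completion_dist v Z Y =
     (if Z \<in> carrier (completion v) \<and> Y \<in> carrier (completion v)
      then completion_abs v (Z \<ominus>\<^bsub>completion v\<^esub> Y) else 0)"

text \<open>\<open>F\<^sub>S\<close> is the product of the completions at the places in \<open>S\<close>; its elements are extensional
  functions on \<open>S\<close>.\<close>

definition F_S_add :: "('a::field \<Rightarrow> real) set \<Rightarrow> (('a \<Rightarrow> real) \<Rightarrow> (nat \<Rightarrow> 'a) set) monoid" where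
  "F_S_add S = product_group S (\<lambda>v. add_monoid (completion v))"

definition F_S_top :: "('a::field \<Rightarrow> real) set \<Rightarrow> (('a \<Rightarrow> real) \<Rightarrow> (nat \<Rightarrow> 'a) set) topology" where
  "F_S_top S = product_topology
     (\<lambda>v. Metric_space.mtopology (carrier (completion v)) (completion_dist v)) S"

definition diag :: "('a::field \<Rightarrow> real) set \<Rightarrow> 'a \<Rightarrow> ('a \<Rightarrow> real) \<Rightarrow> (nat \<Rightarrow> 'a) set" where
  "diag S x = (\<lambda>v\<in>S. to_completion v x)"

definition additive_character ::
    "('a::field \<Rightarrow> real) set \<Rightarrow> ((('a \<Rightarrow> real) \<Rightarrow> (nat \<Rightarrow> 'a) set) \<Rightarrow> complex) \<Rightarrow> bool" where
  "additive_character S \<psi> \<longleftrightarrow>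
     (\<forall>x\<in>carrier (F_S_add S). cmod (\<psi> x) = 1) \<and>
     (\<forall>x\<in>carrier (F_S_add S). \<forall>y\<in>carrier (F_S_add S). \<psi> (x \<otimes>\<^bsub>F_S_add S\<^esub> y) = \<psi> x * \<psi> y) \<and>
     continuous_map (F_S_top S) euclidean \<psi>"

text \<open>The set of \<open>x\<close> below is the largest \<open>\<oo>\<^sub>S\<close>-submodule of the field on which \<open>\<psi>\<close> is trivial.\<close>

definition conductor_S_integers ::
    "('a::field \<Rightarrow> real) set \<Rightarrow> ((('a \<Rightarrow> real) \<Rightarrow> (nat \<Rightarrow> 'a) set) \<Rightarrow> complex) \<Rightarrow> bool" where
  "conductor_S_integers S \<psi> \<longleftrightarrow>
     {x. \<forall>a\<in>S_integers S. \<psi> (diag S (a * x)) = 1} = S_integers S"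


section \<open>Local reciprocity and Hilbert symbols\<close>

text \<open>
  Here \<open>K\<close> is a local field with absolute value \<open>v\<close>, \<open>A\<close> is its algebraic closure and \<open>k\<close> is the
  copy of \<open>K\<close> inside \<open>A\<close>.
\<close>

abbreviation Kbar :: "'k ring \<Rightarrow> (('k list \<times> nat) multiset \<Rightarrow> 'k) ring" where
  "Kbar K \<equiv> field.alg_closure K"

abbreviation into_Kbar :: "'k ring \<Rightarrow> 'k \<Rightarrow> ('k list \<times> nat) multiset \<Rightarrow> 'k" where
  "into_Kbar K \<equiv> ring.indexed_const K"

definition gal :: "'l ring \<Rightarrow> 'l set \<Rightarrow> 'l set \<Rightarrow> ('l \<Rightarrow> 'l) set" where
  "gal A k L = {\<sigma> \<in> ring_iso (A\<lparr>carrier := L\<rparr>) (A\<lparr>carrier := L\<rparr>).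
                  \<sigma> \<in> extensional L \<and> (\<forall>x\<in>k. \<sigma> x = x)}"

definition finite_abelian_ext :: "'l ring \<Rightarrow> 'l set \<Rightarrow> 'l set \<Rightarrow> bool" where
  "finite_abelian_ext A k L \<longleftrightarrow> subfield L A \<and> k \<subseteq> L \<and> ring.finite_dimension A k L \<and>
     {x\<in>L. \<forall>\<sigma>\<in>gal A k L. \<sigma> x = x} = k \<and>
     (\<forall>\<sigma>\<in>gal A k L. \<forall>\<tau>\<in>gal A k L. \<forall>x\<in>L. \<sigma> (\<tau> x) = \<tau> (\<sigma> x))"

text \<open>Product of the conjugates; this is the norm only for Galois \<open>L/k\<close>, as in its use below.\<close>

definition galois_norm :: "'l ring \<Rightarrow> 'l set \<Rightarrow> 'l set \<Rightarrow> 'l \<Rightarrow> 'l" where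
  "galois_norm A k L x = finprod A (\<lambda>\<sigma>. \<sigma> x) (gal A k L)"

text \<open>The ring of elements of \<open>L\<close> integral over the subset \<open>O\<^sub>k\<close>; polynomials are coefficient lists,
  leading coefficient first.\<close>

definition integral_closure_in :: "'l ring \<Rightarrow> 'l set \<Rightarrow> 'l set \<Rightarrow> 'l ring" where
  "integral_closure_in A Ok L = A\<lparr>carrier :=
     {x\<in>L. \<exists>p. p \<noteq> [] \<and> set p \<subseteq> Ok \<and> hd p = \<one>\<^bsub>A\<^esub> \<and> ring.eval A p x = \<zero>\<^bsub>A\<^esub>}\<rparr>"

definition uniformizer :: "'k ring \<Rightarrow> ('k \<Rightarrow> real) \<Rightarrow> 'k \<Rightarrow> bool" where
  "uniformizer K v p \<longleftrightarrow> p \<in> carrier K \<and> p \<noteq> \<zero>\<^bsub>K\<^esub> \<and> v p < 1 \<and>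
     (\<forall>x\<in>carrier K. v x < 1 \<longrightarrow> v x \<le> v p)"

text \<open>
  The local reciprocity law: there is exactly one homomorphism \<open>\<theta>\<close> from \<open>K\<^sup>\<times>\<close> to the Galois group of
  the maximal abelian extension such that, for every finite abelian \<open>L/K\<close>, the kernel of \<open>\<theta>\<close> on
  \<open>L\<close> is the norm group of \<open>L\<close>, and such that uniformizers act as the arithmetic Frobenius on
  unramified extensions. In the archimedean case the last condition is void.
\<close>

definition is_artin_map ::
    "'k ring \<Rightarrow> ('k \<Rightarrow> real) \<Rightarrow>
     ('k \<Rightarrow> (('k list \<times> nat) multiset \<Rightarrow> 'k) \<Rightarrow> (('k list \<times> nat) multiset \<Rightarrow> 'k)) \<Rightarrow> bool" where
  "is_artin_map K v \<theta> \<longleftrightarrow>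
    (let A = Kbar K; \<iota> = into_Kbar K; k = \<iota> ` carrier K; Kx = carrier K - {\<zero>\<^bsub>K\<^esub>} in
     \<forall>L. finite_abelian_ext A k L \<longrightarrow>
       (\<forall>a\<in>Kx. restrict (\<theta> a) L \<in> gal A k L) \<and>
       (\<forall>a\<in>Kx. \<forall>b\<in>Kx. \<forall>x\<in>L. \<theta> (a \<otimes>\<^bsub>K\<^esub> b) x = \<theta> a (\<theta> b x)) \<and>
       (\<forall>a\<in>Kx. (\<forall>x\<in>L. \<theta> a x = x) \<longleftrightarrow> \<iota> a \<in> galois_norm A k L ` (L - {\<zero>\<^bsub>A\<^esub>})) \<and>
       (let OL = integral_closure_in A (\<iota> ` carrier (val_ring K v)) L in
        \<forall>p. nonarch K v \<and> uniformizer K v p \<and> maximalideal (PIdl\<^bsub>OL\<^esub> (\<iota> p)) OL \<longrightarrow>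
          (\<forall>x\<in>carrier OL. \<theta> p x \<ominus>\<^bsub>A\<^esub> x [^]\<^bsub>A\<^esub> residue_card K v \<in> PIdl\<^bsub>OL\<^esub> (\<iota> p))))"

definition artin_map ::
    "'k ring \<Rightarrow> ('k \<Rightarrow> real) \<Rightarrow>
     'k \<Rightarrow> (('k list \<times> nat) multiset \<Rightarrow> 'k) \<Rightarrow> (('k list \<times> nat) multiset \<Rightarrow> 'k)" where
  "artin_map K v = (SOME \<theta>. is_artin_map K v \<theta>)"

text \<open>
  The convention is \<open>(a, b) = \<theta>\<^sub>b(\<alpha>) / \<alpha>\<close> with \<open>\<alpha>\<^sup>m = a\<close>. By the global reciprocity law this
  choice (and not its inverse) gives \<open>(c/d) = (d, c)\<^sub>S (d/c)\<close> for the residue symbols below: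
  at a place \<open>v \<notin> S\<close> dividing \<open>c\<close>, \<open>\<theta>\<^sub>c(\<alpha>) / \<alpha>\<close> with \<open>\<alpha>\<^sup>m = d\<close> is the contribution of \<open>v\<close> to
  \<open>(d/c)\<close>; at a place dividing \<open>d\<close> it is the inverse of the contribution to \<open>(c/d)\<close>.
\<close>

definition hilbert_symbol :: "'k ring \<Rightarrow> ('k \<Rightarrow> real) \<Rightarrow> nat \<Rightarrow> 'k \<Rightarrow> 'k \<Rightarrow> 'k" where
  "hilbert_symbol K v m a b =
     (THE z. z \<in> carrier K \<and> z [^]\<^bsub>K\<^esub> m = \<one>\<^bsub>K\<^esub> \<and>
        (\<forall>\<alpha>\<in>carrier (Kbar K). \<alpha> [^]\<^bsub>Kbar K\<^esub> m = into_Kbar K a \<longrightarrow>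
           artin_map K v b \<alpha> = into_Kbar K z \<otimes>\<^bsub>Kbar K\<^esub> \<alpha>))"

text \<open>
  Roots of unity of the field are identified with complex ones by \<open>\<epsilon>\<close>, so that symbols
  may be multiplied with values of \<open>\<psi>\<close>.
\<close>

definition unity_embedding :: "nat \<Rightarrow> ('a::field \<Rightarrow> complex) \<Rightarrow> bool" where
  "unity_embedding m \<epsilon> \<longleftrightarrow> bij_betw \<epsilon> {x. x ^ m = 1} {z. z ^ m = 1} \<and>
     (\<forall>x y. x ^ m = 1 \<and> y ^ m = 1 \<longrightarrow> \<epsilon> (x * y) = \<epsilon> x * \<epsilon> y)"

definition hilbert_S ::
    "nat \<Rightarrow> ('a::field \<Rightarrow> real) set \<Rightarrow> ('a \<Rightarrow> complex) \<Rightarrow> 'a \<Rightarrow> 'a \<Rightarrow> complex" where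
  "hilbert_S m S \<epsilon> a b =
     (\<Prod>v\<in>S. \<epsilon> (THE \<zeta>. \<zeta> ^ m = 1 \<and> to_completion v \<zeta> =
        hilbert_symbol (completion v) (completion_abs v) m (to_completion v a) (to_completion v b)))"


section \<open>Power residue symbols\<close>

definition coprime_S :: "('a::field \<Rightarrow> real) set \<Rightarrow> 'a \<Rightarrow> 'a \<Rightarrow> bool" where
  "coprime_S S a b \<longleftrightarrow> 1 gcdof\<^bsub>\<oo> S\<^esub> a b"

definition prime_residue_symbol ::
    "('a::field \<Rightarrow> real) set \<Rightarrow> ('a \<Rightarrow> complex) \<Rightarrow> nat \<Rightarrow> 'a \<Rightarrow> 'a \<Rightarrow> complex" where
  "prime_residue_symbol S \<epsilon> m c p =
     (if p divides\<^bsub>\<oo> S\<^esub> c then 0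
      else \<epsilon> (THE \<zeta>. \<zeta> ^ m = 1 \<and> p divides\<^bsub>\<oo> S\<^esub> (c ^ ((ideal_norm S p - 1) div m) - \<zeta>)))"

text \<open>\<open>fs\<close> is a factorization of \<open>d\<close>, up to a unit, into prime elements of the principal ideal
  domain \<open>\<oo>\<^sub>S\<close>.\<close>

definition residue_symbol ::
    "('a::field \<Rightarrow> real) set \<Rightarrow> ('a \<Rightarrow> complex) \<Rightarrow> nat \<Rightarrow> 'a \<Rightarrow> 'a \<Rightarrow> complex" where
  "residue_symbol S \<epsilon> m c d =
     (let fs = (SOME fs. set fs \<subseteq> carrier (mult_of (\<oo> S)) \<and> wfactors (mult_of (\<oo> S)) fs d)
      in prod_list (map (prime_residue_symbol S \<epsilon> m c) fs))"


section \<open>The coefficients \<open>H\<close>\<close>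

text \<open>Chosen representatives of \<open>(\<oo>\<^sub>S/d)\<^sup>\<times>\<close>, and an inverse of \<open>c\<close> modulo \<open>d\<close>.
  The sums below do not depend on these choices.\<close>

definition reduced_residues :: "('a::field \<Rightarrow> real) set \<Rightarrow> 'a \<Rightarrow> 'a set" where
  "reduced_residues S d =
     {c \<in> (\<lambda>Z. SOME x. x \<in> Z) ` carrier (\<oo> S Quot PIdl\<^bsub>\<oo> S\<^esub> d). coprime_S S c d}"

definition inv_mod :: "('a::field \<Rightarrow> real) set \<Rightarrow> 'a \<Rightarrow> 'a \<Rightarrow> 'a" where
  "inv_mod S c d = (SOME u. u \<in> S_integers S \<and> d divides\<^bsub>\<oo> S\<^esub> (c * u - 1))"

text \<open>The nonzero classes of \<open>\<oo>\<^sub>S/\<oo>\<^sub>S\<^sup>\<times>\<close> are represented by the elements of \<open>R\<close>. The individual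
  terms in the definition of \<open>H\<close> are not visibly invariant under units, so \<open>R\<close> is an explicit parameter.\<close>

definition unit_representatives :: "('a::field \<Rightarrow> real) set \<Rightarrow> 'a set \<Rightarrow> bool" where
  "unit_representatives S R \<longleftrightarrow> R \<subseteq> S_integers S - {0} \<and>
     (\<forall>x\<in>S_integers S - {0}. \<exists>!y. y \<in> R \<and> y \<sim>\<^bsub>\<oo> S\<^esub> x)"

definition eps :: "nat \<Rightarrow> nat \<Rightarrow> nat" where
  "eps r i = (if i = r then 2 else 1)"

definition frakd :: "nat \<Rightarrow> (nat \<Rightarrow> 'a::field) \<Rightarrow> nat \<Rightarrow> 'a" where
  "frakd r d j =
     (if j = r then (\<Prod>k=r..2*r-1. d k)
      else (\<Prod>k=j..r-1. d k) * d r ^ 2 * (\<Prod>k=r+1..2*r-j. d k) * (\<Prod>k=2*r-j+1..2*r-1. d k ^ 2))"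

text \<open>For \<open>r \<ge> 2\<close>, with \<open>d = (d\<^sub>1, \<dots>, d\<^bsub>2r-1\<^esub>)\<close> and
  \<open>D = (D\<^sub>2, \<dots>, D\<^sub>r)\<close>.\<close>

definition H_index ::
    "('a::field \<Rightarrow> real) set \<Rightarrow> 'a set \<Rightarrow> nat \<Rightarrow> (nat \<Rightarrow> 'a) \<Rightarrow> (nat \<Rightarrow> 'a) \<Rightarrow>
     ((nat \<Rightarrow> 'a) \<times> (nat \<Rightarrow> 'a)) set" where
  "H_index S R r C m =
     {(d, D). d \<in> {1..2*r-1} \<rightarrow>\<^sub>E R \<and> D \<in> {2..r} \<rightarrow>\<^sub>E R \<and>
        C 1 \<sim>\<^bsub>\<oo> S\<^esub> frakd r d 1 \<and> (\<forall>i\<in>{2..r}. C i \<sim>\<^bsub>\<oo> S\<^esub> frakd r d i * D i) \<and>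
        (\<forall>j\<in>{1..r-1}. d (j+1) divides\<^bsub>\<oo> S\<^esub> (m (j+1) * d j)) \<and>
        (\<forall>j\<in>{1..r-2}. (d (j+1) * d (2*r-j)) divides\<^bsub>\<oo> S\<^esub> (m (j+1) * d j * d (2*r-j-1))) \<and>
        d (r+1) divides\<^bsub>\<oo> S\<^esub> (m r * d (r-1))}"

definition psi_arg ::
    "nat \<Rightarrow> (nat \<Rightarrow> 'a::field) \<Rightarrow> (nat \<Rightarrow> 'a) \<Rightarrow> (nat \<Rightarrow> 'a) \<Rightarrow> (nat \<Rightarrow> 'a) \<Rightarrow> 'a" where
  "psi_arg r m d c u =
     m 1 * (c 1 / d 1) +
     (\<Sum>j=1..r-1. m (j+1) *
        (u j * c (j+1) / d (j+1)
         + (-1) ^ eps r (j+1) * (d j * c (2*r-j) * u (2*r-1-j) / (d (j+1) * d (2*r-j)))))"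

text \<open>Indexed from 2 to \<open>r\<close>; shifted by one in the recursion for \<open>H\<close>.\<close>

definition lower_m :: "nat \<Rightarrow> (nat \<Rightarrow> 'a::field) \<Rightarrow> (nat \<Rightarrow> 'a) \<Rightarrow> nat \<Rightarrow> 'a" where
  "lower_m r m d i =
     (if i = r then m r * d (r-1) / d (r+1)
      else m i * d (i-1) * d (2*r-i) / (d i * d (2*r-i+1)))"

text \<open>Vectors of length \<open>r\<close> are functions of which only the values on \<open>{1..r}\<close> matter. The value at
  \<open>r = 0\<close> is a dummy.\<close>

primrec H_coeff ::
    "nat \<Rightarrow> ('a::field \<Rightarrow> real) set \<Rightarrow> ('a \<Rightarrow> complex) \<Rightarrow>
     ((('a \<Rightarrow> real) \<Rightarrow> (nat \<Rightarrow> 'a) set) \<Rightarrow> complex) \<Rightarrow> 'a set \<Rightarrow>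
     nat \<Rightarrow> (nat \<Rightarrow> 'a) \<Rightarrow> (nat \<Rightarrow> 'a) \<Rightarrow> complex" where
  "H_coeff n S \<epsilon> \<psi> R 0 C m = 1"
| "H_coeff n S \<epsilon> \<psi> R (Suc k) C m =
    (if k = 0 then
       (\<Sum>c\<in>reduced_residues S (C 1).
          residue_symbol S \<epsilon> n c (C 1) ^ 2 * \<psi> (diag S (m 1 * c / C 1)))
     else
       (let r = Suc k in
        \<Sum>(d, D)\<in>H_index S R r C m. \<Sum>c\<in>(\<Pi>\<^sub>E i\<in>{1..2*r-1}. reduced_residues S (d i)).
          (\<Prod>i=1..r. residue_symbol S \<epsilon> n (c i) (d i)
                      * residue_symbol S \<epsilon> n (c (2*r-i)) (d (2*r-i)))
          * (\<Prod>i=1..r-1. \<Prod>j=2*r-i..2*r-1. hilbert_S (2*n) S \<epsilon> (d (2*r-i) / d i) (d j))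
          * (\<Prod>i=2..r. hilbert_S (2*n) S \<epsilon> (frakd r d (i-1) / frakd r d i) (D i)
                        powi (- int (eps r i)))
          * \<psi> (diag S (psi_arg r m d c (\<lambda>i. inv_mod S (c i) (d i))))
          * of_nat (ideal_norm S (d r) ^ (2*r-2))
          * (\<Prod>j=1..r-1. of_nat (ideal_norm S (d j ^ (j-1) * d (r+j) ^ (r+j-2))))
          * H_coeff n S \<epsilon> \<psi> R k (\<lambda>i. D (Suc i)) (\<lambda>i. lower_m r m d (Suc i))))"

end

theory Submission
  imports Defs
begin

text \<open>
  The twist by \<open>m'\<close> is absorbed by a change of variables. In the sum over \<open>c\<^sub>k\<close> modulo \<open>d\<^sub>k\<close>, replace
  \<open>c\<^sub>k\<close> by \<open>M\<^sub>k c\<^sub>k\<close>, where \<open>M\<^sub>k\<close> is a product of entries of \<open>m'\<close>; this permutes the reduced residues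
  because \<open>m'\<close> is prime to \<open>C\<close> and all \<open>d\<^sub>k\<close> divide \<open>C\<^sub>1\<close>. The inverses \<open>u\<^sub>k\<close> change by
  \<open>M\<^sub>k\<^sup>-\<^sup>1\<close>. The terms of the argument of \<open>\<psi>\<close> link \<open>u\<^sub>j\<close> with \<open>c\<^bsub>j+1\<^esub>\<close>, and \<open>u\<^bsub>2r-1-j\<^esub>\<close> with
  \<open>c\<^bsub>2r-j\<^esub>\<close>, with coefficient \<open>m\<^bsub>j+1\<^esub>\<close> in both cases. So if \<open>M\<^bsub>j+1\<^esub> = m'\<^bsub>j+1\<^esub> M\<^sub>j\<close> and
  \<open>M\<^bsub>2r-j\<^esub> = m'\<^bsub>j+1\<^esub> M\<^bsub>2r-1-j\<^esub>\<close>, starting with \<open>M\<^sub>1 = m'\<^sub>1\<close>, the substitution turns \<open>m\<^sub>i\<close> into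
  \<open>m\<^sub>i m'\<^sub>i\<close> up to \<open>S\<close>-integers, on which \<open>\<psi>\<close> is trivial (\<open>psi_arg_scaled\<close>).

  The residue symbols \<open>(c\<^sub>k/d\<^sub>k)\<close> acquire the factors \<open>(M\<^sub>k/d\<^sub>k)\<close>. By bimultiplicativity these
  combine to the product of the symbols of \<open>m'\<^sub>i\<close> at \<open>frakd\<^sub>i\<close> with exponents \<open>eps r i\<close>
  (\<open>residue_symbol_scale_prod\<close>). The coefficient of rank \<open>r-1\<close> inside the sum has the arguments
  \<open>D\<^sub>i\<close> and is twisted by the same \<open>m'\<^sub>i\<close>, so by induction it contributes the symbols at \<open>D\<^sub>i\<close>;
  since \<open>C\<^sub>i\<close> is \<open>frakd\<^sub>i D\<^sub>i\<close> up to a unit, the total factor is the same for all terms. The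
  summation range does not change, and Hilbert symbols and norms are not affected.

  The facts about the power residue symbol that enter are multiplicativity in both arguments,
  periodicity in the upper one, invariance under units in the lower one, and nonvanishing on coprime
  arguments. They follow from the definition, as \<open>n\<close> is a unit and the field contains
  \<open>n\<close> distinct \<open>n\<close>-th roots of unity.
\<close>

section \<open>Arithmetic of the ring of S-integers\<close>

text \<open>The ring of \<open>S\<close>-integers, assumed to be a principal ideal domain. Divisibility
  and coprimality are those of \<open>\<oo> S\<close>; a congruence \<open>x \<equiv> y\<close> modulo
  \<open>d\<close> is expressed as divisibility of \<open>x - y\<close> by \<open>d\<close>.\<close>

locale pid_S_integers =
  fixes S :: "('a::field_char_0 \<Rightarrow> real) set"
  assumes principal: "principal_domain (\<oo> S)"
begin

sublocale O: principal_domain "\<oo> S"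
  by (rule principal)

lemma S_ring_simps [simp]:
  "carrier (\<oo> S) = S_integers S"
  "x \<otimes>\<^bsub>\<oo> S\<^esub> y = x * y" "x \<oplus>\<^bsub>\<oo> S\<^esub> y = x + y"
  "\<zero>\<^bsub>\<oo> S\<^esub> = 0" "\<one>\<^bsub>\<oo> S\<^esub> = 1"
  by (simp_all add: S_ring_def ring_of_type_algebra_def)

lemma mult_closed [intro, simp]: "x \<in> S_integers S \<Longrightarrow> y \<in> S_integers S \<Longrightarrow> x * y \<in> S_integers S"
  using O.m_closed[of x y] by simp

lemma add_closed [intro, simp]: "x \<in> S_integers S \<Longrightarrow> y \<in> S_integers S \<Longrightarrow> x + y \<in> S_integers S"
  using O.a_closed[of x y] by simp

lemma one_closed [intro, simp]: "1 \<in> S_integers S"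
  using O.one_closed by simp

lemma zero_closed [intro, simp]: "0 \<in> S_integers S"
  using O.zero_closed by simp

lemma uminus_closed [intro, simp]: "x \<in> S_integers S \<Longrightarrow> - x \<in> S_integers S"
proof -
  assume x: "x \<in> S_integers S"
  have "x + \<ominus>\<^bsub>\<oo> S\<^esub> x = 0" "\<ominus>\<^bsub>\<oo> S\<^esub> x \<in> S_integers S"
    using O.r_neg[of x] O.a_inv_closed[of x] x by simp_all
  thus ?thesis by (simp add: add_eq_0_iff)
qed

lemma diff_closed [intro, simp]: "x \<in> S_integers S \<Longrightarrow> y \<in> S_integers S \<Longrightarrow> x - y \<in> S_integers S"
  using add_closed[of x "- y"] by simp

lemma power_closed [intro, simp]: "x \<in> S_integers S \<Longrightarrow> x ^ k \<in> S_integers S"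
  by (induction k) auto

lemma prod_closed [intro]: "(\<And>i. i \<in> I \<Longrightarrow> f i \<in> S_integers S) \<Longrightarrow> prod f I \<in> S_integers S"
  by (induction I rule: infinite_finite_induct) auto

lemma sum_closed [intro]: "(\<And>i. i \<in> I \<Longrightarrow> f i \<in> S_integers S) \<Longrightarrow> sum f I \<in> S_integers S"
  by (induction I rule: infinite_finite_induct) auto

lemma divides_iff: "a divides\<^bsub>\<oo> S\<^esub> b \<longleftrightarrow> (\<exists>c\<in>S_integers S. b = a * c)"
  by (simp add: factor_def)

lemma divides_iff_quotient: "a \<noteq> 0 \<Longrightarrow> a divides\<^bsub>\<oo> S\<^esub> b \<longleftrightarrow> b / a \<in> S_integers S"
  by (auto simp: divides_iff intro!: bexI[of _ "b / a"])

lemma divides_add: "d divides\<^bsub>\<oo> S\<^esub> x \<Longrightarrow> d divides\<^bsub>\<oo> S\<^esub> y \<Longrightarrow> d divides\<^bsub>\<oo> S\<^esub> (x + y)"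
  unfolding divides_iff by (metis add_closed distrib_left)

lemma divides_uminus: "d divides\<^bsub>\<oo> S\<^esub> x \<Longrightarrow> d divides\<^bsub>\<oo> S\<^esub> (- x)"
  unfolding divides_iff by (metis uminus_closed mult_minus_right)

lemma divides_diff: "d divides\<^bsub>\<oo> S\<^esub> x \<Longrightarrow> d divides\<^bsub>\<oo> S\<^esub> y \<Longrightarrow> d divides\<^bsub>\<oo> S\<^esub> (x - y)"
  using divides_add[of d x "- y"] divides_uminus[of d y] by simp

lemma divides_diff_commute: "d divides\<^bsub>\<oo> S\<^esub> (x - y) \<Longrightarrow> d divides\<^bsub>\<oo> S\<^esub> (y - x)"
  using divides_uminus[of d "x - y"] by simp

lemma divides_mult_right: "d divides\<^bsub>\<oo> S\<^esub> x \<Longrightarrow> y \<in> S_integers S \<Longrightarrow> d divides\<^bsub>\<oo> S\<^esub> (x * y)"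
  unfolding divides_iff by (metis mult_closed mult.assoc)

lemma divides_mult_left: "d divides\<^bsub>\<oo> S\<^esub> x \<Longrightarrow> y \<in> S_integers S \<Longrightarrow> d divides\<^bsub>\<oo> S\<^esub> (y * x)"
  using divides_mult_right by (simp add: mult.commute)

lemma divides_trans: "a divides\<^bsub>\<oo> S\<^esub> b \<Longrightarrow> b divides\<^bsub>\<oo> S\<^esub> c \<Longrightarrow> a divides\<^bsub>\<oo> S\<^esub> c"
  unfolding divides_iff by (metis mult_closed mult.assoc)

lemma divides_diff_trans:
  "d divides\<^bsub>\<oo> S\<^esub> (x - y) \<Longrightarrow> d divides\<^bsub>\<oo> S\<^esub> (y - z) \<Longrightarrow> d divides\<^bsub>\<oo> S\<^esub> (x - z)"
  using divides_add[of d "x - y" "y - z"] by simp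

lemma divides_mult_diff:
  assumes "d divides\<^bsub>\<oo> S\<^esub> (x - x')" "d divides\<^bsub>\<oo> S\<^esub> (y - y')"
    and "x' \<in> S_integers S" "y \<in> S_integers S"
  shows "d divides\<^bsub>\<oo> S\<^esub> (x * y - x' * y')"
  using divides_add[OF divides_mult_right[OF assms(1,4)] divides_mult_left[OF assms(2,3)]]
  by (simp add: algebra_simps)

lemma divides_power_diff:
  assumes "d divides\<^bsub>\<oo> S\<^esub> (x - y)" "x \<in> S_integers S" "y \<in> S_integers S"
  shows "d divides\<^bsub>\<oo> S\<^esub> (x ^ k - y ^ k)"
proof (induction k)
  case 0
  then show ?case by (auto simp: divides_iff intro!: bexI[of _ 0])
next
  case (Suc k)
  then show ?case using divides_mult_diff[OF assms(1) Suc] assms by simp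
qed

lemma divides_prod: "finite I \<Longrightarrow> i \<in> I \<Longrightarrow> (\<And>j. j \<in> I \<Longrightarrow> f j \<in> S_integers S) \<Longrightarrow>
    f i divides\<^bsub>\<oo> S\<^esub> prod f I"
  by (auto simp: divides_iff prod.remove[of I i] intro!: bexI[of _ "prod f (I - {i})"] prod_closed)

lemma coprime_S_iff_bezout:
  assumes "a \<in> S_integers S" "b \<in> S_integers S"
  shows "coprime_S S a b \<longleftrightarrow> (\<exists>x\<in>S_integers S. \<exists>y\<in>S_integers S. a * x + b * y = 1)"
proof
  assume "coprime_S S a b"
  hence "PIdl\<^bsub>\<oo> S\<^esub> 1 = PIdl\<^bsub>\<oo> S\<^esub> a <+>\<^bsub>\<oo> S\<^esub> PIdl\<^bsub>\<oo> S\<^esub> b"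
    using O.ideal_sum_iff_gcd[of a b 1] assms by (simp add: coprime_S_def)
  moreover have "1 \<in> PIdl\<^bsub>\<oo> S\<^esub> 1"
    using O.cgenideal_self[of 1] by simp
  ultimately have "1 \<in> PIdl\<^bsub>\<oo> S\<^esub> a <+>\<^bsub>\<oo> S\<^esub> PIdl\<^bsub>\<oo> S\<^esub> b" by simp
  then show "\<exists>x\<in>S_integers S. \<exists>y\<in>S_integers S. a * x + b * y = 1"
    by (force simp: set_add_def' cgenideal_def mult.commute)
next
  assume "\<exists>x\<in>S_integers S. \<exists>y\<in>S_integers S. a * x + b * y = 1"
  then obtain x y where xy: "x \<in> S_integers S" "y \<in> S_integers S" "a * x + b * y = 1" by blast
  have "c divides\<^bsub>\<oo> S\<^esub> 1" if "c divides\<^bsub>\<oo> S\<^esub> a" "c divides\<^bsub>\<oo> S\<^esub> b" for c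
    using divides_add[OF divides_mult_right[OF that(1) xy(1)] divides_mult_right[OF that(2) xy(2)]]
    by (simp add: xy)
  moreover have "1 divides\<^bsub>\<oo> S\<^esub> a" "1 divides\<^bsub>\<oo> S\<^esub> b"
    using assms by (auto simp: divides_iff)
  ultimately show "coprime_S S a b"
    by (simp add: coprime_S_def isgcd_def)
qed

lemma coprime_S_bezoutI:
  assumes "a * x + b * y = 1" "a \<in> S_integers S" "b \<in> S_integers S" "x \<in> S_integers S" "y \<in> S_integers S"
  shows "coprime_S S a b"
  using assms coprime_S_iff_bezout by blast

lemma coprime_S_bezoutE:
  assumes "coprime_S S a b" "a \<in> S_integers S" "b \<in> S_integers S"
  obtains x y where "x \<in> S_integers S" "y \<in> S_integers S" "a * x + b * y = 1"
  using assms coprime_S_iff_bezout by blast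

lemma coprime_S_commute: "coprime_S S a b \<longleftrightarrow> coprime_S S b a"
  by (auto simp: coprime_S_def isgcd_def)

lemma coprime_S_one_left: "b \<in> S_integers S \<Longrightarrow> coprime_S S 1 b"
  by (rule coprime_S_bezoutI[of 1 1 b 0]) auto

lemma coprime_S_mult_left:
  assumes "coprime_S S a c" "coprime_S S b c"
    and ab: "a \<in> S_integers S" "b \<in> S_integers S" "c \<in> S_integers S"
  shows "coprime_S S (a * b) c"
proof -
  obtain x y where xy: "x \<in> S_integers S" "y \<in> S_integers S" "a * x + c * y = 1"
    using coprime_S_bezoutE assms by metis
  obtain z w where zw: "z \<in> S_integers S" "w \<in> S_integers S" "b * z + c * w = 1"
    using coprime_S_bezoutE assms by metis
  have "(a * b) * (x * z) + c * (a * x * w + y) = a * x * (b * z + c * w) + c * y"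
    by (simp add: algebra_simps)
  also have "\<dots> = 1" using xy zw by simp
  finally show ?thesis
    by (rule coprime_S_bezoutI) (use xy zw ab in auto)
qed

lemma coprime_S_prod_left:
  assumes "\<And>i. i \<in> I \<Longrightarrow> f i \<in> S_integers S \<and> coprime_S S (f i) c" "c \<in> S_integers S"
  shows "coprime_S S (prod f I) c"
  using assms
  by (induction I rule: infinite_finite_induct)
     (auto simp: coprime_S_one_left intro!: coprime_S_mult_left prod_closed)

lemma coprime_S_divisors:
  assumes "coprime_S S a b" "x divides\<^bsub>\<oo> S\<^esub> a" "y divides\<^bsub>\<oo> S\<^esub> b"
    and "x \<in> S_integers S" "y \<in> S_integers S"
  shows "coprime_S S x y"
proof -
  have "c divides\<^bsub>\<oo> S\<^esub> 1" if "c \<in> S_integers S" "c divides\<^bsub>\<oo> S\<^esub> x" "c divides\<^bsub>\<oo> S\<^esub> y" for c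
    using assms(1) that divides_trans[OF that(2) assms(2)] divides_trans[OF that(3) assms(3)]
    by (auto simp: coprime_S_def isgcd_def)
  moreover have "1 divides\<^bsub>\<oo> S\<^esub> x" "1 divides\<^bsub>\<oo> S\<^esub> y"
    using assms by (auto simp: divides_iff)
  ultimately show ?thesis by (simp add: coprime_S_def isgcd_def)
qed

lemma coprime_S_divides_mult_iff:
  assumes "coprime_S S b d" "b \<in> S_integers S" "d \<in> S_integers S" "x \<in> S_integers S"
  shows "d divides\<^bsub>\<oo> S\<^esub> (x * b) \<longleftrightarrow> d divides\<^bsub>\<oo> S\<^esub> x"
proof
  assume *: "d divides\<^bsub>\<oo> S\<^esub> (x * b)"
  obtain z w where zw: "z \<in> S_integers S" "w \<in> S_integers S" "b * z + d * w = 1"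
    using coprime_S_bezoutE assms by metis
  have "d divides\<^bsub>\<oo> S\<^esub> (x * b * z)" using * zw divides_mult_right by blast
  moreover have "d divides\<^bsub>\<oo> S\<^esub> (d * (w * x))" using zw assms by (auto simp: divides_iff)
  ultimately have "d divides\<^bsub>\<oo> S\<^esub> (x * b * z + d * (w * x))" by (rule divides_add)
  also have "x * b * z + d * (w * x) = x * (b * z + d * w)" by (simp add: algebra_simps)
  finally show "d divides\<^bsub>\<oo> S\<^esub> x" using zw by simp
qed (use assms divides_mult_right in blast)

lemma inv_mod:
  assumes "coprime_S S c d" "c \<in> S_integers S" "d \<in> S_integers S"
  shows "inv_mod S c d \<in> S_integers S" "d divides\<^bsub>\<oo> S\<^esub> (c * inv_mod S c d - 1)"
proof -
  obtain z w where zw: "z \<in> S_integers S" "w \<in> S_integers S" "c * z + d * w = 1"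
    using coprime_S_bezoutE assms by metis
  have "c * z - 1 = d * (- w)" using zw by (simp add: algebra_simps)
  hence "\<exists>u. u \<in> S_integers S \<and> d divides\<^bsub>\<oo> S\<^esub> (c * u - 1)"
    using zw uminus_closed unfolding divides_iff by blast
  from someI_ex[OF this]
  show "inv_mod S c d \<in> S_integers S" "d divides\<^bsub>\<oo> S\<^esub> (c * inv_mod S c d - 1)"
    by (auto simp: inv_mod_def)
qed

text \<open>If \<open>x\<close> is congruent to \<open>M c\<close> modulo \<open>d\<close>, then the inverses are related the other
  way round: the inverse of \<open>c\<close> is congruent to \<open>M\<close> times the inverse of \<open>x\<close>.\<close>

lemma inv_mod_scaled:
  assumes "d divides\<^bsub>\<oo> S\<^esub> (x - M * c)" and cop: "coprime_S S x d" "coprime_S S c d"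
    and mem: "x \<in> S_integers S" "c \<in> S_integers S" "M \<in> S_integers S" "d \<in> S_integers S"
  shows "d divides\<^bsub>\<oo> S\<^esub> (inv_mod S c d - M * inv_mod S x d)"
proof -
  define u v where "u = inv_mod S c d" and "v = inv_mod S x d"
  have u: "u \<in> S_integers S" "d divides\<^bsub>\<oo> S\<^esub> (c * u - 1)"
    and v: "v \<in> S_integers S" "d divides\<^bsub>\<oo> S\<^esub> (x * v - 1)"
    using inv_mod cop mem by (auto simp: u_def v_def)
  have "u - M * v = (c * u - 1) * (M * v) - u * (x * v - 1) + (x - M * c) * (u * v)"
    by (simp add: algebra_simps)
  moreover have "d divides\<^bsub>\<oo> S\<^esub> \<dots>"
    using divides_add[OF divides_diff[OF divides_mult_right[OF u(2), of "M * v"] divides_mult_left[OF v(2), of u]]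
        divides_mult_right[OF assms(1), of "u * v"]] u(1) v(1) mem by simp
  ultimately show ?thesis by (simp add: u_def v_def)
qed

section \<open>Reduced residues\<close>

lemma a_r_coset_PIdl:
  assumes "d \<in> S_integers S" "x \<in> S_integers S"
  shows "PIdl\<^bsub>\<oo> S\<^esub> d +>\<^bsub>\<oo> S\<^esub> x = {y \<in> S_integers S. d divides\<^bsub>\<oo> S\<^esub> (y - x)}"
proof (intro equalityI subsetI)
  fix y assume "y \<in> PIdl\<^bsub>\<oo> S\<^esub> d +>\<^bsub>\<oo> S\<^esub> x"
  thus "y \<in> {y \<in> S_integers S. d divides\<^bsub>\<oo> S\<^esub> (y - x)}"
    using assms by (auto simp: a_r_coset_def' cgenideal_def divides_iff mult.commute)
next
  fix y assume "y \<in> {y \<in> S_integers S. d divides\<^bsub>\<oo> S\<^esub> (y - x)}"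
  then obtain c where "c \<in> S_integers S" "y = c * d + x"
    by (auto simp: divides_iff algebra_simps)
  thus "y \<in> PIdl\<^bsub>\<oo> S\<^esub> d +>\<^bsub>\<oo> S\<^esub> x"
    by (force simp: a_r_coset_def' cgenideal_def)
qed

lemma carrier_Quot:
  "carrier (\<oo> S Quot I) = (\<lambda>x. I +>\<^bsub>\<oo> S\<^esub> x) ` S_integers S"
  by (auto simp: FactRing_def A_RCOSETS_def' )

text \<open>The set of reduced residues is defined from choices of coset representatives. All that matters
  about it is this: every class prime to the modulus meets it exactly once.\<close>

lemma reduced_residues_unique:
  assumes d: "d \<in> S_integers S" and x: "x \<in> S_integers S" "coprime_S S x d"
  shows "\<exists>!y. y \<in> reduced_residues S d \<and> d divides\<^bsub>\<oo> S\<^esub> (y - x)"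
proof -
  define co where "co = (\<lambda>x. {y \<in> S_integers S. d divides\<^bsub>\<oo> S\<^esub> (y - x)})"
  define f where "f = (\<lambda>x. SOME y. y \<in> co x)"
  have rr: "reduced_residues S d = {c \<in> f ` S_integers S. coprime_S S c d}"
    unfolding reduced_residues_def carrier_Quot image_image f_def co_def
    using d by (intro Collect_cong conj_cong refl arg_cong2[where f="(\<in>)"] image_cong) (simp_all add: a_r_coset_PIdl)
  have mem: "f z \<in> co z" if "z \<in> S_integers S" for z
    unfolding f_def by (rule someI[of _ z]) (use that in \<open>simp add: co_def divides_iff bexI[of _ 0]\<close>)
  have eq: "f z = f w" if "d divides\<^bsub>\<oo> S\<^esub> (z - w)" "z \<in> S_integers S" "w \<in> S_integers S" for z w
  proof -
    have "co z = co w" unfolding co_def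
      using that divides_diff_trans divides_diff_commute[OF that(1)] by (intro Collect_cong) blast
    thus ?thesis by (simp add: f_def)
  qed
  have "coprime_S S (f x) d"
  proof -
    obtain a b where ab: "a \<in> S_integers S" "b \<in> S_integers S" "x * a + d * b = 1"
      using coprime_S_bezoutE x d by metis
    obtain k where k: "k \<in> S_integers S" "f x - x = d * k" 
      using mem[OF x(1)] by (auto simp: co_def divides_iff)
    have "f x * a + d * (b - k * a) = (f x - x) * a - d * k * a + (x * a + d * b)"
      by (simp add: algebra_simps)
    also have "\<dots> = 1" using ab k by simp
    finally show ?thesis
      by (rule coprime_S_bezoutI) (use ab k d mem[OF x(1)] in \<open>auto simp: co_def\<close>)
  qed
  hence fx: "f x \<in> reduced_residues S d" "d divides\<^bsub>\<oo> S\<^esub> (f x - x)"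
    using mem[OF x(1)] x by (auto simp: rr co_def)
  show ?thesis
  proof (rule ex1I[of _ "f x"])
    fix y assume y: "y \<in> reduced_residues S d \<and> d divides\<^bsub>\<oo> S\<^esub> (y - x)"
    then obtain z where z: "z \<in> S_integers S" "y = f z" by (auto simp: rr)
    have "d divides\<^bsub>\<oo> S\<^esub> (z - x)"
      using mem[OF z(1)] y z divides_diff_trans[OF divides_diff_commute, of d "f z" z x] by (simp add: co_def)
    thus "y = f x" using eq z x by auto
  qed (use fx in auto)
qed

lemma reduced_residues_mem:
  assumes "d \<in> S_integers S" "c \<in> reduced_residues S d"
  shows "c \<in> S_integers S" "coprime_S S c d"
proof -
  show "coprime_S S c d" using assms by (simp add: reduced_residues_def)
  obtain x where x: "x \<in> S_integers S" "c = (SOME y. y \<in> PIdl\<^bsub>\<oo> S\<^esub> d +>\<^bsub>\<oo> S\<^esub> x)"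
    using assms unfolding reduced_residues_def carrier_Quot by auto
  have "x \<in> PIdl\<^bsub>\<oo> S\<^esub> d +>\<^bsub>\<oo> S\<^esub> x"
    using x assms by (simp add: a_r_coset_PIdl divides_iff bexI[of _ 0])
  hence "c \<in> PIdl\<^bsub>\<oo> S\<^esub> d +>\<^bsub>\<oo> S\<^esub> x" using x(2) by (metis someI)
  thus "c \<in> S_integers S" using x assms by (simp add: a_r_coset_PIdl)
qed

text \<open>Multiplication by \<open>M\<close>, followed by passage to the chosen representative. The sums over reduced
  residues may be reindexed by it without knowing that they are finite.\<close>

lemma bij_betw_scale_reduced_residues:
  assumes d: "d \<in> S_integers S" and M: "M \<in> S_integers S" "coprime_S S M d"
  obtains f where "bij_betw f (reduced_residues S d) (reduced_residues S d)"
    "\<And>c. c \<in> reduced_residues S d \<Longrightarrow> d divides\<^bsub>\<oo> S\<^esub> (f c - M * c)"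
proof -
  let ?R = "reduced_residues S d"
  define f where "f c = (THE y. y \<in> ?R \<and> d divides\<^bsub>\<oo> S\<^esub> (y - M * c))" for c
  have f: "f c \<in> ?R" "d divides\<^bsub>\<oo> S\<^esub> (f c - M * c)" if "c \<in> ?R" for c
    using theI'[OF reduced_residues_unique[OF d, of "M * c"]] reduced_residues_mem[OF d that] M d
    by (auto simp: f_def intro: coprime_S_mult_left)
  have "inj_on f ?R"
  proof (rule inj_onI)
    fix c c' assume c: "c \<in> ?R" "c' \<in> ?R" "f c = f c'"
    note mem = reduced_residues_mem[OF d c(1)] reduced_residues_mem[OF d c(2)]
    have "d divides\<^bsub>\<oo> S\<^esub> (M * c - M * c')"
      using f[OF c(1)] f[OF c(2)] c(3) divides_diff_trans[OF divides_diff_commute, of d "f c" "M * c" "M * c'"]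
      by simp
    hence "d divides\<^bsub>\<oo> S\<^esub> ((c - c') * M)" by (simp add: algebra_simps)
    hence "d divides\<^bsub>\<oo> S\<^esub> (c - c')"
      using coprime_S_divides_mult_iff M d mem by blast
    moreover have "d divides\<^bsub>\<oo> S\<^esub> (c' - c')" by (auto simp: divides_iff)
    ultimately show "c = c'"
      using reduced_residues_unique[OF d, of c'] mem c by blast
  qed
  moreover have "f ` ?R = ?R"
  proof (intro equalityI subsetI)
    fix y assume y: "y \<in> ?R"
    note mem = reduced_residues_mem[OF d y]
    define u where "u = inv_mod S M d"
    have u: "u \<in> S_integers S" "d divides\<^bsub>\<oo> S\<^esub> (M * u - 1)"
      using inv_mod[OF M(2,1) d] by (auto simp: u_def)
    have "coprime_S S u d"
    proof -
      obtain k where k: "k \<in> S_integers S" "M * u - 1 = d * k"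
        using u by (auto simp: divides_iff)
      hence "u * M + d * (- k) = 1" by (simp add: algebra_simps)
      thus ?thesis by (rule coprime_S_bezoutI) (use u d k M in auto)
    qed
    hence "coprime_S S (u * y) d" using u mem d by (auto intro: coprime_S_mult_left)
    then obtain c where c: "c \<in> ?R" "d divides\<^bsub>\<oo> S\<^esub> (c - u * y)"
      using reduced_residues_unique[OF d, of "u * y"] u mem by blast
    have "d divides\<^bsub>\<oo> S\<^esub> (M * (c - u * y) + (M * u - 1) * y)"
      using divides_add[OF divides_mult_left[OF c(2), of M] divides_mult_right[OF u(2), of y]] M mem by simp
    also have "M * (c - u * y) + (M * u - 1) * y = M * c - y" by (simp add: algebra_simps)
    finally have "d divides\<^bsub>\<oo> S\<^esub> (y - M * c)" by (rule divides_diff_commute)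
    moreover have "coprime_S S (M * c) d" "M * c \<in> S_integers S"
      using reduced_residues_mem[OF d c(1)] M d by (auto intro: coprime_S_mult_left)
    ultimately have "f c = y"
      using reduced_residues_unique[OF d, of "M * c"] f[OF c(1)] y by blast
    thus "y \<in> f ` ?R" using c by blast
  qed (use f in auto)
  ultimately show ?thesis using that f by (auto simp: bij_betw_def)
qed

end

lemma bij_betw_PiE_componentwise:
  assumes "\<And>i. i \<in> I \<Longrightarrow> bij_betw (f i) (A i) (B i)"
  shows "bij_betw (\<lambda>x. \<lambda>i\<in>I. f i (x i)) (Pi\<^sub>E I A) (Pi\<^sub>E I B)"
proof (rule bij_betw_byWitness[where f' = "\<lambda>y. \<lambda>i\<in>I. the_inv_into (A i) (f i) (y i)"])
  have inj: "inj_on (f i) (A i)" and img: "f i ` A i = B i" if "i \<in> I" for i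
    using assms[OF that] by (auto simp: bij_betw_def)
  show "\<forall>x\<in>Pi\<^sub>E I A. (\<lambda>i\<in>I. the_inv_into (A i) (f i) ((\<lambda>i\<in>I. f i (x i)) i)) = x"
  proof (intro ballI)
    fix x assume x: "x \<in> Pi\<^sub>E I A"
    show "(\<lambda>i\<in>I. the_inv_into (A i) (f i) ((\<lambda>i\<in>I. f i (x i)) i)) = x"
    proof (rule ext)
      fix i show "(\<lambda>i\<in>I. the_inv_into (A i) (f i) ((\<lambda>i\<in>I. f i (x i)) i)) i = x i"
        using the_inv_into_f_f[OF inj PiE_mem[OF x]] PiE_arb[OF x, of i] by simp
    qed
  qed
  show "\<forall>y\<in>Pi\<^sub>E I B. (\<lambda>i\<in>I. f i ((\<lambda>i\<in>I. the_inv_into (A i) (f i) (y i)) i)) = y"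
  proof (intro ballI)
    fix y assume y: "y \<in> Pi\<^sub>E I B"
    show "(\<lambda>i\<in>I. f i ((\<lambda>i\<in>I. the_inv_into (A i) (f i) (y i)) i)) = y"
    proof (rule ext)
      fix i show "(\<lambda>i\<in>I. f i ((\<lambda>i\<in>I. the_inv_into (A i) (f i) (y i)) i)) i = y i"
        using f_the_inv_into_f[OF inj, of i] img[of i] PiE_mem[OF y, of i] PiE_arb[OF y, of i]
        by simp
    qed
  qed
  show "(\<lambda>x. \<lambda>i\<in>I. f i (x i)) ` Pi\<^sub>E I A \<subseteq> Pi\<^sub>E I B"
  proof (rule image_subsetI)
    fix x assume "x \<in> Pi\<^sub>E I A"
    thus "(\<lambda>i\<in>I. f i (x i)) \<in> Pi\<^sub>E I B"
      unfolding restrict_PiE_iff using img PiE_mem by blast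
  qed
  show "(\<lambda>y. \<lambda>i\<in>I. the_inv_into (A i) (f i) (y i)) ` Pi\<^sub>E I B \<subseteq> Pi\<^sub>E I A"
  proof (rule image_subsetI)
    fix y assume y: "y \<in> Pi\<^sub>E I B"
    show "(\<lambda>i\<in>I. the_inv_into (A i) (f i) (y i)) \<in> Pi\<^sub>E I A"
      unfolding restrict_PiE_iff
    proof
      fix i assume i: "i \<in> I"
      show "the_inv_into (A i) (f i) (y i) \<in> A i"
        using the_inv_into_into[OF inj[OF i], of "y i" "A i"] img[OF i] PiE_mem[OF y i] by simp
    qed
  qed
qed

section \<open>Power residue symbols\<close>

text \<open>The place condition on \<open>n\<close> implies that \<open>n\<close> is a unit of \<open>\<oo> S\<close>. The embedding of the \<open>2n\<close>-th
  roots of unity of the field into the complex numbers is what provides \<open>n\<close> distinct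
  \<open>n\<close>-th roots of unity in the field.\<close>

locale residue_symbols = pid_S_integers S
  for S :: "('a::field_char_0 \<Rightarrow> real) set" +
  fixes n :: nat and \<epsilon> :: "'a \<Rightarrow> complex"
  assumes n_pos: "n \<ge> 1"
    and unity: "unity_embedding (2 * n) \<epsilon>"
    and n_outside: "\<forall>v. place v \<and> v (of_nat n) < 1 \<longrightarrow> (\<exists>w\<in>S. same_place v w)"
begin

lemma root_of_unity_closed:
  assumes "(x::'a) ^ n = 1"
  shows "x \<in> S_integers S"
  unfolding S_integers_def
proof (intro CollectI allI impI)
  fix v assume "place_outside S v \<and> nonarch type_ring v"
  hence v: "\<And>x. 0 \<le> v x" "\<And>x. v x = 0 \<longleftrightarrow> x = 0" "\<And>x y. v (x * y) = v x * v y"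
    by (auto simp: place_outside_def place_def)
  have v1: "v 1 = 1" using v(3)[of 1 1] v(2)[of 1] by simp
  have "v (x ^ k) = v x ^ k" for k by (induction k) (auto simp: v v1)
  hence "v x ^ n = 1" using assms v1 by metis
  thus "v x \<le> 1" using n_pos one_less_power[of "v x" n] by linarith
qed

lemma inverse_n_closed: "1 / of_nat n \<in> S_integers S"
  unfolding S_integers_def
proof (intro CollectI allI impI)
  fix v assume *: "place_outside S v \<and> nonarch type_ring v"
  hence v: "\<And>x. 0 \<le> v x" "\<And>x. v x = 0 \<longleftrightarrow> x = 0" "\<And>x y. v (x * y) = v x * v y"
    by (auto simp: place_outside_def place_def)
  have v1: "v 1 = 1" using v(3)[of 1 1] v(2)[of 1] by simp
  have "v (of_nat n) \<ge> 1" using * n_outside by (force simp: place_outside_def)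
  moreover have "v (of_nat n) * v (1 / of_nat n) = 1"
    using v(3)[of "of_nat n" "1 / of_nat n"] v1 n_pos by simp
  ultimately show "v (1 / of_nat n) \<le> 1"
    using v(1)[of "1 / of_nat n"] by (metis mult_left_mono mult.commute mult_1)
qed

lemma card_roots_unity_n: "card {x::'a. x ^ n = 1} = n" "finite {x::'a. x ^ n = 1}"
proof -
  have bij: "bij_betw \<epsilon> {x. x ^ (2*n) = 1} {z. z ^ (2*n) = 1}"
    and hom: "\<And>x y. x ^ (2*n) = 1 \<Longrightarrow> y ^ (2*n) = 1 \<Longrightarrow> \<epsilon> (x * y) = \<epsilon> x * \<epsilon> y"
    using unity by (auto simp: unity_embedding_def)
  have two: "x ^ (2*n) = 1" if "x ^ n = 1" for x :: "'b :: comm_ring_1"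
    using that by (simp add: power_mult power_commutes mult.commute[of 2])
  have e1: "\<epsilon> 1 = 1"
  proof -
    have "\<epsilon> 1 ^ (2*n) = 1" using bij by (auto simp: bij_betw_def)
    hence "\<epsilon> 1 \<noteq> 0" using n_pos by (auto simp: power_0_left)
    thus ?thesis using hom[of 1 1] by simp
  qed
  have pow: "\<epsilon> (x ^ k) = \<epsilon> x ^ k" if "x ^ (2*n) = 1" for x k
  proof (induction k)
    case (Suc k)
    have "(x ^ k) ^ (2*n) = 1" using that by (metis power_mult mult.commute power_one)
    thus ?case using hom[OF that] Suc by simp
  qed (simp add: e1)
  have "bij_betw \<epsilon> {x. x ^ n = 1} {z. z ^ n = 1}"
    unfolding bij_betw_def
  proof (intro conjI equalityI subsetI)
    show "inj_on \<epsilon> {x. x ^ n = 1}"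
      using bij two by (auto simp: bij_betw_def inj_on_def)
  next
    fix z assume "z \<in> \<epsilon> ` {x. x ^ n = 1}"
    thus "z \<in> {z. z ^ n = 1}" using pow two e1 by (smt (verit) imageE mem_Collect_eq)
  next
    fix z :: complex assume "z \<in> {z. z ^ n = 1}"
    hence z: "z ^ n = 1" by simp
    have "z \<in> \<epsilon> ` {x. x ^ (2*n) = 1}" using bij two[OF z] by (auto simp: bij_betw_def)
    then obtain x where x: "x ^ (2*n) = 1" "z = \<epsilon> x" by auto
    have "(x ^ n) ^ (2*n) = 1" using x by (metis power_mult mult.commute power_one)
    moreover have "\<epsilon> (x ^ n) = \<epsilon> 1" using z x pow e1 by simp
    ultimately have "x ^ n = 1" using bij by (auto simp: bij_betw_def inj_on_def)
    thus "z \<in> \<epsilon> ` {x. x ^ n = 1}" using x by auto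
  qed
  moreover have "card {z::complex. z ^ n = 1} = n"
    using card_complex_roots_unity n_pos by blast
  ultimately show "card {x::'a. x ^ n = 1} = n" by (simp add: bij_betw_same_card)
  thus "finite {x::'a. x ^ n = 1}" using n_pos card.infinite by fastforce
qed

lemma unity_embedding_root:
  assumes "(x::'a) ^ n = 1" "y ^ n = 1"
  shows "\<epsilon> (x * y) = \<epsilon> x * \<epsilon> y" "\<epsilon> x \<noteq> 0"
proof -
  have two: "z ^ (2*n) = 1" if "z ^ n = 1" for z :: 'a
    using that by (simp add: power_mult mult.commute[of 2])
  show "\<epsilon> (x * y) = \<epsilon> x * \<epsilon> y" using unity two assms by (auto simp: unity_embedding_def)
  have "\<epsilon> x ^ (2*n) = 1" using unity two assms by (auto simp: unity_embedding_def bij_betw_def)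
  thus "\<epsilon> x \<noteq> 0" using n_pos by (auto simp: power_0_left)
qed

text \<open>Prime elements of \<open>\<oo> S\<close>; zero is excluded.\<close>

definition prime_elem_S :: "'a \<Rightarrow> bool" where
  "prime_elem_S p \<longleftrightarrow> p \<in> S_integers S \<and> ring_prime\<^bsub>\<oo> S\<^esub> p"

lemma prime_elem_S_nonunit:
  assumes "prime_elem_S p"
  shows "\<not> p divides\<^bsub>\<oo> S\<^esub> 1"
proof -
  have "p \<in> carrier (\<oo> S)" "p \<notin> Units (\<oo> S)"
    using assms unfolding prime_elem_S_def ring_prime_def Divisibility.prime_def by simp_all
  thus ?thesis using O.divides_one[of p] unfolding S_ring_simps by blast
qed

lemma prime_elem_S_mult:
  assumes "prime_elem_S p" "p divides\<^bsub>\<oo> S\<^esub> (a * b)" "a \<in> S_integers S" "b \<in> S_integers S"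
  shows "p divides\<^bsub>\<oo> S\<^esub> a \<or> p divides\<^bsub>\<oo> S\<^esub> b"
  using assms unfolding prime_elem_S_def ring_prime_def Divisibility.prime_def S_ring_simps by blast

text \<open>Distinct \<open>n\<close>-th roots of unity stay distinct modulo a prime: if \<open>z \<noteq> 1\<close> is an \<open>n\<close>-th root of
  unity congruent to 1, then \<open>0 = 1 + z + \<dots> + z\<^bsup>n-1\<^esup>\<close> is congruent to the unit \<open>n\<close>.\<close>

lemma roots_of_unity_congruent_eq:
  assumes p: "prime_elem_S p" and x: "x ^ n = 1" "y ^ n = 1" and dvd: "p divides\<^bsub>\<oo> S\<^esub> (x - y)"
  shows "x = y"
proof (rule ccontr)
  assume "x \<noteq> y"
  define z where "z = x / y"
  have y0: "y \<noteq> 0" using x n_pos by (auto simp: power_0_left)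
  have z: "z ^ n = 1" "z \<noteq> 1" using x \<open>x \<noteq> y\<close> y0 by (auto simp: z_def power_divide)
  have iy: "inverse y \<in> S_integers S" using x by (intro root_of_unity_closed) (simp add: power_inverse)
  have "p divides\<^bsub>\<oo> S\<^esub> (z - 1)"
    using divides_mult_right[OF dvd iy] y0 by (simp add: z_def field_simps)
  hence "p divides\<^bsub>\<oo> S\<^esub> (z ^ k - 1)" for k
    using divides_power_diff[of p z 1 k] z root_of_unity_closed by simp
  hence "p divides\<^bsub>\<oo> S\<^esub> (\<Sum>k<m. z ^ k - 1)" for m
    by (induction m) (simp_all add: divides_add divides_iff[of p 0] bexI[of _ 0])
  moreover have "(\<Sum>k<n. z ^ k - 1) = - of_nat n"
    using z geometric_sum[of z n] by (simp add: sum_subtractf)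
  ultimately have "p divides\<^bsub>\<oo> S\<^esub> (- of_nat n)" by metis
  hence "p divides\<^bsub>\<oo> S\<^esub> (- (- of_nat n) * (1 / of_nat n))"
    by (rule divides_mult_right[OF divides_uminus inverse_n_closed])
  thus False using prime_elem_S_nonunit[OF p] n_pos by simp
qed

text \<open>Euler's criterion in the form needed for the symbol. In a finite residue field with
  \<open>q + 1\<close> elements the \<open>n\<close>-th roots of unity of the field form a subgroup of order \<open>n\<close> of the
  multiplicative group, so \<open>n\<close> divides \<open>q\<close> by Lagrange; and since \<open>X\<^sup>n = 1\<close> has at most \<open>n\<close>
  solutions, \<open>c\<^bsup>q/n\<^esup>\<close> is one of them.\<close>

lemma residue_root_exists:
  assumes p: "prime_elem_S p" and c: "c \<in> S_integers S" "\<not> p divides\<^bsub>\<oo> S\<^esub> c"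
  shows "\<exists>z. z ^ n = 1 \<and> p divides\<^bsub>\<oo> S\<^esub> (c ^ ((ideal_norm S p - 1) div n) - z)"
proof (cases "ideal_norm S p = 0")
  case True
  \<comment> \<open>An infinite residue field would have cardinality 0 by convention; the exponent is then 0.\<close>
  thus ?thesis by (intro exI[of _ 1]) (simp add: divides_iff bexI[of _ 0])
next
  case False
  define Q where "Q = \<oo> S Quot PIdl\<^bsub>\<oo> S\<^esub> p"
  define h where "h x = PIdl\<^bsub>\<oo> S\<^esub> p +>\<^bsub>\<oo> S\<^esub> x" for x
  define G where "G = Multiplicative_Group.mult_of Q"
  have pO: "p \<in> S_integers S" "p \<noteq> 0" "ring_prime\<^bsub>\<oo> S\<^esub> p"
    using p by (auto simp: prime_elem_S_def ring_prime_def)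
  interpret Q: field Q
    using O.field_iff_prime[of p] pO by (simp add: Q_def)
  interpret I: ideal "PIdl\<^bsub>\<oo> S\<^esub> p" "\<oo> S"
    using O.cgenideal_ideal[of p] pO by simp
  interpret G: group G
    unfolding G_def by (rule Q.field_mult_group)
  have h_closed: "h x \<in> carrier Q" if "x \<in> S_integers S" for x
    using that by (auto simp: Q_def carrier_Quot h_def)
  have h_mult: "h (x * y) = h x \<otimes>\<^bsub>Q\<^esub> h y" if "x \<in> S_integers S" "y \<in> S_integers S" for x y
    using ring_hom_mult[OF I.rcos_ring_hom] that by (simp add: Q_def h_def[abs_def])
  have h_one: "h 1 = \<one>\<^bsub>Q\<^esub>"
    using ring_hom_one[OF I.rcos_ring_hom] by (simp add: Q_def h_def[abs_def])
  have h_pow: "h (x ^ k) = h x [^]\<^bsub>Q\<^esub> k" if "x \<in> S_integers S" for x k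
    by (induction k) (use that in \<open>simp_all add: h_one h_mult Q.nat_pow_Suc2 h_closed mult.commute Q.m_comm\<close>)
  have h_eq: "h x = h y \<longleftrightarrow> p divides\<^bsub>\<oo> S\<^esub> (x - y)" if "x \<in> S_integers S" "y \<in> S_integers S" for x y
  proof
    assume "h x = h y"
    moreover have "x \<in> h x"
      using that pO by (simp add: h_def a_r_coset_PIdl divides_iff bexI[of _ 0])
    ultimately show "p divides\<^bsub>\<oo> S\<^esub> (x - y)" using that pO by (simp add: h_def a_r_coset_PIdl)
  next
    assume d: "p divides\<^bsub>\<oo> S\<^esub> (x - y)"
    show "h x = h y"
      unfolding h_def a_r_coset_PIdl[OF pO(1) that(1)] a_r_coset_PIdl[OF pO(1) that(2)]
      using divides_diff_trans[OF _ d] divides_diff_trans[OF _ divides_diff_commute[OF d]] by blast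
  qed
  have h_zero: "h 0 = \<zero>\<^bsub>Q\<^esub>"
    using ring_hom_zero[OF I.rcos_ring_hom O.ring_axioms] Q.ring_axioms
    by (simp add: Q_def h_def[abs_def])
  have fin: "finite (carrier Q)" and q: "card (carrier Q) = ideal_norm S p"
    using False card.infinite by (fastforce simp: Q_def ideal_norm_def)+
  define q where "q = ideal_norm S p - 1"
  have ordG: "order G = q"
    using Q.order_mult_of[OF fin] q by (simp add: G_def order_def q_def)
  have nz: "h x \<in> carrier G" if "x \<in> S_integers S" "\<not> p divides\<^bsub>\<oo> S\<^esub> x" for x
    using that h_eq[of x 0] h_closed[of x] h_zero by (simp add: G_def)
  define U where "U = h ` {x. x ^ n = 1}"
  have root_mem: "h x \<in> carrier G" if "x ^ n = 1" for x
  proof (rule nz)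
    show "x \<in> S_integers S" using root_of_unity_closed that by blast
    show "\<not> p divides\<^bsub>\<oo> S\<^esub> x"
    proof
      assume "p divides\<^bsub>\<oo> S\<^esub> x"
      moreover have "x ^ (n - 1) \<in> S_integers S" using root_of_unity_closed[OF that] by simp
      ultimately have "p divides\<^bsub>\<oo> S\<^esub> (x * x ^ (n - 1))" by (rule divides_mult_right)
      thus False using prime_elem_S_nonunit[OF p] that n_pos
        power_minus_mult[of n x] by (simp add: mult.commute)
    qed
  qed
  have inj: "inj_on h {x. x ^ n = 1}"
    using roots_of_unity_congruent_eq[OF p] h_eq root_of_unity_closed by (intro inj_onI) simp
  hence cardU: "card U = n" unfolding U_def using card_roots_unity_n by (simp add: card_image)
  have "subgroup U G"
  proof (rule G.subgroupI)
    show "U \<subseteq> carrier G" "U \<noteq> {}"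
      using root_mem power_one[of n] unfolding U_def by blast+
  next
    fix a assume "a \<in> U"
    then obtain x where x: "x ^ n = 1" "a = h x" by (auto simp: U_def)
    have x0: "x \<noteq> 0" using x n_pos by (auto simp: power_0_left)
    have i: "inverse x ^ n = 1" using x by (simp add: power_inverse)
    have "h (inverse x) \<otimes>\<^bsub>G\<^esub> a = \<one>\<^bsub>G\<^esub>"
      using h_mult[of "inverse x" x] root_of_unity_closed x i x0 h_one by (simp add: G_def)
    hence "inv\<^bsub>G\<^esub> a = h (inverse x)"
      using G.inv_equality root_mem x i by blast
    thus "inv\<^bsub>G\<^esub> a \<in> U" using i by (auto simp: U_def)
  next
    fix a b assume "a \<in> U" "b \<in> U"
    then obtain x y where x: "x ^ n = 1" "a = h x" "y ^ n = 1" "b = h y" by (auto simp: U_def)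
    have "a \<otimes>\<^bsub>G\<^esub> b = h (x * y)"
      using x h_mult[of x y] root_of_unity_closed by (simp add: G_def)
    moreover have "(x * y) ^ n = 1" using x by (simp add: power_mult_distrib)
    ultimately show "a \<otimes>\<^bsub>G\<^esub> b \<in> U" by (auto simp: U_def)
  qed
  hence "n dvd q" using G.lagrange[of U] cardU ordG by (metis dvd_triv_right)
  hence q_eq: "(q div n) * n = q" by simp
  have "(h c [^]\<^bsub>Q\<^esub> (q div n)) [^]\<^bsub>Q\<^esub> n = h c [^]\<^bsub>Q\<^esub> q"
    using Q.nat_pow_pow[OF h_closed[OF c(1)], of "q div n" n] q_eq by simp
  also have "\<dots> = \<one>\<^bsub>Q\<^esub>"
    using G.pow_order_eq_1[OF nz[OF c]] ordG by (simp add: G_def Multiplicative_Group.nat_pow_mult_of)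
  finally have "h c [^]\<^bsub>Q\<^esub> (q div n) \<in> {x \<in> carrier Q. x [^]\<^bsub>Q\<^esub> n = \<one>\<^bsub>Q\<^esub>}"
    using h_closed c by simp
  moreover have "U = {x \<in> carrier Q. x [^]\<^bsub>Q\<^esub> n = \<one>\<^bsub>Q\<^esub>}"
  proof (rule card_seteq)
    show "finite {x \<in> carrier Q. x [^]\<^bsub>Q\<^esub> n = \<one>\<^bsub>Q\<^esub>}" using fin by simp
    show "U \<subseteq> {x \<in> carrier Q. x [^]\<^bsub>Q\<^esub> n = \<one>\<^bsub>Q\<^esub>}"
    proof
      fix a assume "a \<in> U"
      then obtain x where x: "x ^ n = 1" "a = h x" by (auto simp: U_def)
      show "a \<in> {x \<in> carrier Q. x [^]\<^bsub>Q\<^esub> n = \<one>\<^bsub>Q\<^esub>}"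
        using h_closed[OF root_of_unity_closed[OF x(1)]] h_pow[OF root_of_unity_closed[OF x(1)], of n] x h_one
        by simp
    qed
    show "card {x \<in> carrier Q. x [^]\<^bsub>Q\<^esub> n = \<one>\<^bsub>Q\<^esub>} \<le> card U"
      using Q.num_roots_le_deg[OF fin, of n] n_pos cardU by simp
  qed
  ultimately have "h (c ^ (q div n)) \<in> h ` {x. x ^ n = 1}"
    using h_pow[OF c(1)] unfolding U_def by simp
  then obtain z where z: "z ^ n = 1" "h (c ^ (q div n)) = h z" by blast
  hence "p divides\<^bsub>\<oo> S\<^esub> (c ^ (q div n) - z)"
    using h_eq[of "c ^ (q div n)" z] c root_of_unity_closed by simp
  thus ?thesis using z(1) unfolding q_def by blast
qed

lemma residue_root_ex1:
  assumes p: "prime_elem_S p" and c: "c \<in> S_integers S" "\<not> p divides\<^bsub>\<oo> S\<^esub> c"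
  shows "\<exists>!z. z ^ n = 1 \<and> p divides\<^bsub>\<oo> S\<^esub> (c ^ ((ideal_norm S p - 1) div n) - z)"
proof -
  obtain z where z: "z ^ n = 1" "p divides\<^bsub>\<oo> S\<^esub> (c ^ ((ideal_norm S p - 1) div n) - z)"
    using residue_root_exists[OF assms] by blast
  show ?thesis
  proof (rule ex1I[of _ z])
    fix w assume w: "w ^ n = 1 \<and> p divides\<^bsub>\<oo> S\<^esub> (c ^ ((ideal_norm S p - 1) div n) - w)"
    show "w = z"
      using roots_of_unity_congruent_eq[OF p, of w z] w z
        divides_diff_trans[OF divides_diff_commute, of p _ w z] by blast
  qed (use z in simp)
qed

lemma prime_residue_symbol_eq:
  assumes p: "prime_elem_S p" and c: "c \<in> S_integers S" "\<not> p divides\<^bsub>\<oo> S\<^esub> c"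
    and z: "z ^ n = 1" "p divides\<^bsub>\<oo> S\<^esub> (c ^ ((ideal_norm S p - 1) div n) - z)"
  shows "prime_residue_symbol S \<epsilon> n c p = \<epsilon> z"
  using the1_equality[OF residue_root_ex1[OF p c]] z c by (simp add: prime_residue_symbol_def)

lemma prime_residue_symbol_mult:
  assumes p: "prime_elem_S p" and c: "c \<in> S_integers S" "c' \<in> S_integers S"
  shows "prime_residue_symbol S \<epsilon> n (c * c') p =
    prime_residue_symbol S \<epsilon> n c p * prime_residue_symbol S \<epsilon> n c' p"
proof (cases "p divides\<^bsub>\<oo> S\<^esub> c \<or> p divides\<^bsub>\<oo> S\<^esub> c'")
  case True
  hence "p divides\<^bsub>\<oo> S\<^esub> (c * c')" using c divides_mult_left divides_mult_right by blast
  thus ?thesis using True by (auto simp: prime_residue_symbol_def)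
next
  case False
  hence nd: "\<not> p divides\<^bsub>\<oo> S\<^esub> (c * c')" using prime_elem_S_mult[OF p] c by blast
  let ?e = "(ideal_norm S p - 1) div n"
  obtain z where z: "z ^ n = 1" "p divides\<^bsub>\<oo> S\<^esub> (c ^ ?e - z)"
    using residue_root_exists[OF p c(1)] False by blast
  obtain w where w: "w ^ n = 1" "p divides\<^bsub>\<oo> S\<^esub> (c' ^ ?e - w)"
    using residue_root_exists[OF p c(2)] False by blast
  have "p divides\<^bsub>\<oo> S\<^esub> ((c * c') ^ ?e - z * w)"
    using divides_mult_diff[OF z(2) w(2)] c z w root_of_unity_closed
    by (simp add: power_mult_distrib)
  moreover have "(z * w) ^ n = 1" using z w by (simp add: power_mult_distrib)
  ultimately have "prime_residue_symbol S \<epsilon> n (c * c') p = \<epsilon> (z * w)"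
    using prime_residue_symbol_eq[OF p mult_closed[OF c] nd] by blast
  thus ?thesis
    using prime_residue_symbol_eq[OF p c(1) _ z] prime_residue_symbol_eq[OF p c(2) _ w] False
      unity_embedding_root z w by simp
qed

lemma prime_residue_symbol_cong:
  assumes p: "prime_elem_S p" and c: "c \<in> S_integers S" "c' \<in> S_integers S"
    and d: "p divides\<^bsub>\<oo> S\<^esub> (c - c')"
  shows "prime_residue_symbol S \<epsilon> n c p = prime_residue_symbol S \<epsilon> n c' p"
proof -
  have iff: "p divides\<^bsub>\<oo> S\<^esub> c \<longleftrightarrow> p divides\<^bsub>\<oo> S\<^esub> c'"
    using divides_add[OF d, of c'] divides_diff[OF _ d, of c] by auto
  show ?thesis
  proof (cases "p divides\<^bsub>\<oo> S\<^esub> c'")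
    case False
    obtain z where z: "z ^ n = 1" "p divides\<^bsub>\<oo> S\<^esub> (c' ^ ((ideal_norm S p - 1) div n) - z)"
      using residue_root_exists[OF p c(2)] False by blast
    have "p divides\<^bsub>\<oo> S\<^esub> (c ^ ((ideal_norm S p - 1) div n) - z)"
      using divides_diff_trans[OF divides_power_diff[OF d c] z(2)] .
    thus ?thesis using prime_residue_symbol_eq[OF p] c iff False z by metis
  qed (use iff in \<open>simp add: prime_residue_symbol_def\<close>)
qed

lemma prime_residue_symbol_nonzero:
  assumes p: "prime_elem_S p" and c: "c \<in> S_integers S" "\<not> p divides\<^bsub>\<oo> S\<^esub> c"
  shows "prime_residue_symbol S \<epsilon> n c p \<noteq> 0"
  using residue_root_exists[OF p c] prime_residue_symbol_eq[OF p c] unity_embedding_root by metis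

lemma prime_residue_symbol_associated:
  assumes "p \<in> S_integers S" "p' \<in> S_integers S" "p \<sim>\<^bsub>\<oo> S\<^esub> p'"
  shows "prime_residue_symbol S \<epsilon> n c p = prime_residue_symbol S \<epsilon> n c p'"
proof -
  have "PIdl\<^bsub>\<oo> S\<^esub> p = PIdl\<^bsub>\<oo> S\<^esub> p'"
    using assms O.associated_iff_same_ideal[of p p'] by simp
  hence "ideal_norm S p = ideal_norm S p'" by (simp add: ideal_norm_def)
  moreover have "p divides\<^bsub>\<oo> S\<^esub> x \<longleftrightarrow> p' divides\<^bsub>\<oo> S\<^esub> x" for x
    using assms(3) divides_trans unfolding associated_def by blast
  ultimately show ?thesis by (simp add: prime_residue_symbol_def)
qed

text \<open>Factorizations into irreducible elements up to a unit, as in the definition of the residue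
  symbol.\<close>

abbreviation factorization :: "'a list \<Rightarrow> 'a \<Rightarrow> bool" where
  "factorization fs d \<equiv> set fs \<subseteq> carrier (mult_of (\<oo> S)) \<and> wfactors (mult_of (\<oo> S)) fs d"

lemma factorization_prime:
  assumes "factorization fs d" "p \<in> set fs"
  shows "prime_elem_S p"
proof -
  have p: "p \<in> S_integers S" "p \<noteq> 0" "irreducible (mult_of (\<oo> S)) p"
    using assms by (auto simp: wfactors_def)
  hence "ring_irreducible\<^bsub>\<oo> S\<^esub> p"
    using O.irreducible_mult_imp_irreducible[of p] by (simp add: ring_irreducible_def)
  thus ?thesis using O.primeness_condition[of p] p by (simp add: prime_elem_S_def)
qed

lemma factorization_exists: "d \<in> S_integers S - {0} \<Longrightarrow> \<exists>fs. factorization fs d"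
  using O.mult_of.wfactors_exist[of d] by simp

lemma factorization_divides:
  assumes f: "factorization fs d" and d: "d \<in> S_integers S - {0}" and p: "p \<in> set fs"
  shows "p divides\<^bsub>\<oo> S\<^esub> d"
proof -
  have mem: "set fs \<subseteq> S_integers S" using f by auto
  have pr: "foldr (*) xs 1 \<in> S_integers S" if "set xs \<subseteq> S_integers S" for xs
    using that by (induction xs) auto
  have "p divides\<^bsub>\<oo> S\<^esub> foldr (*) xs 1" if "p \<in> set xs" "set xs \<subseteq> S_integers S" for xs
    using that
  proof (induction xs)
    case (Cons a xs)
    show ?case
    proof (cases "p = a")
      case True
      thus ?thesis using pr[of xs] Cons.prems by (auto simp: divides_iff)
    next
      case False
      thus ?thesis using Cons divides_mult_left by simp
    qed
  qed simp
  hence "p divides\<^bsub>\<oo> S\<^esub> foldr (*) fs 1" using p mem by blast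
  moreover have mult_eq: "(\<otimes>\<^bsub>\<oo> S\<^esub>) = (*)" by (intro ext) simp
  have "foldr (*) fs 1 divides\<^bsub>\<oo> S\<^esub> d"
    using f by (auto simp: wfactors_def associated_def mult_eq)
  ultimately show ?thesis by (rule divides_trans)
qed

text \<open>By unique factorization the choice of a factorization is immaterial, because the symbol at a
  prime depends only on the associate class of the prime.\<close>

lemma residue_symbol_eq:
  assumes f: "factorization fs d" and d: "d \<in> S_integers S - {0}"
  shows "residue_symbol S \<epsilon> n c d = prod_list (map (prime_residue_symbol S \<epsilon> n c) fs)"
proof -
  define gs where "gs = (SOME fs. factorization fs d)"
  have g: "factorization gs d" unfolding gs_def using f by (rule someI)
  have "essentially_equal (mult_of (\<oo> S)) gs fs"
    using O.mult_of.wfactors_unique[of gs d fs] f g d by auto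
  then obtain gs' where gs': "mset gs = mset gs'" "list_all2 (\<sim>\<^bsub>mult_of (\<oo> S)\<^esub>) gs' fs"
    by (auto simp: essentially_equal_def)
  have set_gs': "set gs' \<subseteq> S_integers S"
    using g mset_eq_setD[OF gs'(1)] by auto
  have "prod_list (map (prime_residue_symbol S \<epsilon> n c) gs) = prod_list (map (prime_residue_symbol S \<epsilon> n c) gs')"
    using gs'(1) by (metis mset_map prod_mset_prod_list)
  also have "map (prime_residue_symbol S \<epsilon> n c) gs' = map (prime_residue_symbol S \<epsilon> n c) fs"
  proof (rule nth_equalityI)
    fix i assume i: "i < length (map (prime_residue_symbol S \<epsilon> n c) gs')"
    have len: "length gs' = length fs" using gs'(2) by (rule list_all2_lengthD)
    have mem: "gs' ! i \<in> S_integers S" "fs ! i \<in> S_integers S"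
      using i len set_gs' f nth_mem[of i gs'] nth_mem[of i fs] by (auto simp: subset_iff)
    have "gs' ! i \<sim>\<^bsub>mult_of (\<oo> S)\<^esub> fs ! i" using gs'(2) i by (auto simp: list_all2_conv_all_nth)
    hence "gs' ! i \<sim>\<^bsub>\<oo> S\<^esub> fs ! i"
      using O.assoc_iff_assoc_mult[of "gs' ! i" "fs ! i"] mem by simp
    thus "map (prime_residue_symbol S \<epsilon> n c) gs' ! i = map (prime_residue_symbol S \<epsilon> n c) fs ! i"
      using prime_residue_symbol_associated[OF mem] i len by simp
  qed (use gs'(2) in \<open>simp add: list_all2_lengthD\<close>)
  finally show ?thesis by (simp add: residue_symbol_def gs_def)
qed

lemma residue_symbol_mult_top:
  assumes "c \<in> S_integers S" "c' \<in> S_integers S" "d \<in> S_integers S - {0}"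
  shows "residue_symbol S \<epsilon> n (c * c') d = residue_symbol S \<epsilon> n c d * residue_symbol S \<epsilon> n c' d"
proof -
  obtain fs where fs: "factorization fs d" using factorization_exists assms by blast
  have "prod_list (map (prime_residue_symbol S \<epsilon> n (c * c')) xs) =
      prod_list (map (prime_residue_symbol S \<epsilon> n c) xs) * prod_list (map (prime_residue_symbol S \<epsilon> n c') xs)"
    if "\<forall>p\<in>set xs. prime_elem_S p" for xs
    using that by (induction xs) (simp_all add: prime_residue_symbol_mult assms)
  thus ?thesis using residue_symbol_eq[OF fs assms(3)] factorization_prime[OF fs] by simp
qed

lemma residue_symbol_cong:
  assumes "d divides\<^bsub>\<oo> S\<^esub> (c - c')" "c \<in> S_integers S" "c' \<in> S_integers S" "d \<in> S_integers S - {0}"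
  shows "residue_symbol S \<epsilon> n c d = residue_symbol S \<epsilon> n c' d"
proof -
  obtain fs where fs: "factorization fs d" using factorization_exists assms by blast
  have "map (prime_residue_symbol S \<epsilon> n c) fs = map (prime_residue_symbol S \<epsilon> n c') fs"
    using assms factorization_prime[OF fs] factorization_divides[OF fs]
    by (intro map_cong refl prime_residue_symbol_cong) (auto intro: divides_trans)
  thus ?thesis unfolding residue_symbol_eq[OF fs assms(4)] by (rule arg_cong)
qed

lemma residue_symbol_nonzero:
  assumes "coprime_S S c d" "c \<in> S_integers S" "d \<in> S_integers S - {0}"
  shows "residue_symbol S \<epsilon> n c d \<noteq> 0"
proof -
  obtain fs where fs: "factorization fs d" using factorization_exists assms by blast
  have "prime_residue_symbol S \<epsilon> n c p \<noteq> 0" if p: "p \<in> set fs" for p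
  proof (rule prime_residue_symbol_nonzero[OF factorization_prime[OF fs p] assms(2)])
    show "\<not> p divides\<^bsub>\<oo> S\<^esub> c"
    proof
      assume "p divides\<^bsub>\<oo> S\<^esub> c"
      hence "p divides\<^bsub>\<oo> S\<^esub> 1"
        using assms(1) factorization_divides[OF fs assms(3) p] factorization_prime[OF fs p]
        by (auto simp: coprime_S_def isgcd_def prime_elem_S_def)
      thus False using prime_elem_S_nonunit factorization_prime[OF fs p] by blast
    qed
  qed
  thus ?thesis using residue_symbol_eq[OF fs assms(3)] by (auto simp: prod_list_zero_iff)
qed

lemma residue_symbol_mult_bottom:
  assumes "d \<in> S_integers S - {0}" "d' \<in> S_integers S - {0}"
  shows "residue_symbol S \<epsilon> n c (d * d') = residue_symbol S \<epsilon> n c d * residue_symbol S \<epsilon> n c d'"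
proof -
  obtain fs where fs: "factorization fs d" using factorization_exists assms by blast
  obtain gs where gs: "factorization gs d'" using factorization_exists assms by blast
  have "factorization (fs @ gs) (d * d')"
    using O.mult_of.wfactors_mult[of fs d gs d'] fs gs assms by auto
  from residue_symbol_eq[OF this] residue_symbol_eq[OF fs] residue_symbol_eq[OF gs]
  show ?thesis using assms by simp
qed

lemma residue_symbol_one_bottom: "residue_symbol S \<epsilon> n c 1 = 1"
proof -
  have "factorization [] 1"
    using O.mult_of.unit_wfactors[of 1] O.mult_of.Units_one_closed by simp
  from residue_symbol_eq[OF this] show ?thesis by simp
qed

lemma residue_symbol_associated:
  assumes "d \<in> S_integers S - {0}" "d' \<in> S_integers S - {0}" "d \<sim>\<^bsub>\<oo> S\<^esub> d'"
  shows "residue_symbol S \<epsilon> n c d = residue_symbol S \<epsilon> n c d'"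
proof -
  obtain fs where fs: "factorization fs d" using factorization_exists assms by blast
  have "d \<sim>\<^bsub>mult_of (\<oo> S)\<^esub> d'" using O.assoc_iff_assoc_mult[of d d'] assms by simp
  hence "factorization fs d'"
    using O.mult_of.wfactors_cong_r[of fs d d'] fs assms by auto
  from residue_symbol_eq[OF this] residue_symbol_eq[OF fs] show ?thesis using assms by simp
qed

lemma residue_symbol_one_top:
  assumes "d \<in> S_integers S - {0}"
  shows "residue_symbol S \<epsilon> n 1 d = 1"
  using residue_symbol_mult_top[of 1 1 d] residue_symbol_nonzero[of 1 d] coprime_S_one_left[of d] assms
  by simp

lemma residue_symbol_prod_top:
  assumes "finite I" "\<And>i. i \<in> I \<Longrightarrow> f i \<in> S_integers S" "d \<in> S_integers S - {0}"
  shows "residue_symbol S \<epsilon> n (prod f I) d = (\<Prod>i\<in>I. residue_symbol S \<epsilon> n (f i) d)"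
  using assms(1,2)
proof (induction I)
  case (insert i I)
  have "prod f I \<in> S_integers S" using insert.prems by (intro prod_closed) simp
  thus ?case using insert residue_symbol_mult_top[OF _ _ assms(3)] by simp
qed (simp add: residue_symbol_one_top[OF assms(3)])

lemma residue_symbol_prod_bottom:
  assumes "finite I" "\<And>i. i \<in> I \<Longrightarrow> f i \<in> S_integers S - {0}"
  shows "residue_symbol S \<epsilon> n c (prod f I) = (\<Prod>i\<in>I. residue_symbol S \<epsilon> n c (f i))"
  using assms
proof (induction I)
  case (insert i I)
  have "prod f I \<in> S_integers S - {0}" using insert by (auto intro: prod_closed)
  thus ?case using insert by (simp add: residue_symbol_mult_bottom)
qed (simp add: residue_symbol_one_bottom)

end

section \<open>The additive character on the diagonal\<close>

lemma to_completion_eq: "to_completion v x = {\<lambda>i. h i + x | h. h \<in> null_seqs v}"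
  by (auto simp: to_completion_def a_r_coset_def' cauchy_ring_def)

lemma to_completion_add:
  assumes v: "place v"
  shows "to_completion v x \<oplus>\<^bsub>completion v\<^esub> to_completion v y = to_completion v (x + y)"
proof -
  have add: "add (completion v) A B = {\<lambda>i. a i + b i | a b. a \<in> A \<and> b \<in> B}" for A B
    by (auto simp: completion_def FactRing_def set_add_def' cauchy_ring_def)
  have v_nonneg: "\<And>x. 0 \<le> v x" and tri: "\<And>x y. v (x + y) \<le> v x + v y" and v0: "v 0 = 0"
    using v by (auto simp: place_def)
  have null_add: "(\<lambda>i. h i + k i) \<in> null_seqs v" if "h \<in> null_seqs v" "k \<in> null_seqs v" for h k
  proof -
    have "(\<lambda>i. v (h i) + v (k i)) \<longlonglongrightarrow> 0"
      using tendsto_add[of "\<lambda>i. v (h i)" 0 sequentially "\<lambda>i. v (k i)" 0] that by (simp add: null_seqs_def)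
    hence "(\<lambda>i. v (h i + k i)) \<longlonglongrightarrow> 0"
      by (rule tendsto_sandwich[rotated 2, OF tendsto_const]) (simp_all add: v_nonneg tri)
    thus ?thesis by (simp add: null_seqs_def)
  qed
  have null_0: "(\<lambda>i. 0) \<in> null_seqs v" by (simp add: null_seqs_def v0)
  show ?thesis
  proof (intro equalityI subsetI)
    fix s assume "s \<in> to_completion v x \<oplus>\<^bsub>completion v\<^esub> to_completion v y"
    then obtain h k where hk: "h \<in> null_seqs v" "k \<in> null_seqs v" "s = (\<lambda>i. (h i + x) + (k i + y))"
      by (auto simp: add to_completion_eq)
    hence "s = (\<lambda>i. (\<lambda>i. h i + k i) i + (x + y))" by (simp add: algebra_simps)
    thus "s \<in> to_completion v (x + y)"
      unfolding to_completion_eq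
      by (intro CollectI exI[of _ "\<lambda>i. h i + k i"] conjI null_add hk(1,2))
  next
    fix s assume "s \<in> to_completion v (x + y)"
    then obtain h where h: "h \<in> null_seqs v" "s = (\<lambda>i. h i + (x + y))"
      by (auto simp: to_completion_eq)
    have "(\<lambda>i. h i + x) \<in> to_completion v x"
      unfolding to_completion_eq by (intro CollectI exI[of _ h] conjI refl h(1))
    moreover have "(\<lambda>i. 0 + y) \<in> to_completion v y"
      unfolding to_completion_eq by (intro CollectI exI[of _ "\<lambda>i. 0"] conjI refl null_0)
    moreover have "s = (\<lambda>i. (h i + x) + (0 + y))"
      using h by (simp add: algebra_simps)
    ultimately show "s \<in> to_completion v x \<oplus>\<^bsub>completion v\<^esub> to_completion v y"
      unfolding add
      by (intro CollectI exI[of _ "\<lambda>i. h i + x"] exI[of _ "\<lambda>i. 0 + y"] conjI)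
  qed
qed

lemma to_completion_closed:
  assumes "place v"
  shows "to_completion v x \<in> carrier (completion v)"
proof -
  have "v 0 = 0" using assms by (simp add: place_def)
  hence "(\<lambda>_. x) \<in> carrier (cauchy_ring v)" by (simp add: cauchy_ring_def)
  thus ?thesis by (auto simp: completion_def FactRing_def A_RCOSETS_def' to_completion_def)
qed

lemma diag_closed: "\<forall>v\<in>S. place v \<Longrightarrow> diag S x \<in> carrier (F_S_add S)"
  by (simp add: diag_def F_S_add_def to_completion_closed)

lemma diag_add:
  "\<forall>v\<in>S. place v \<Longrightarrow> diag S x \<otimes>\<^bsub>F_S_add S\<^esub> diag S y = diag S (x + y)"
  by (auto simp: diag_def F_S_add_def to_completion_add fun_eq_iff)

text \<open>By the condition on its conductor \<open>\<psi>\<close> is trivial on the \<open>S\<close>-integers, so on the diagonal it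
  is constant on cosets of \<open>\<oo> S\<close>.\<close>

lemma (in pid_S_integers) additive_character_cong:
  assumes "\<forall>v\<in>S. place v" "additive_character S \<psi>" "conductor_S_integers S \<psi>"
    and "x - y \<in> S_integers S"
  shows "\<psi> (diag S x) = \<psi> (diag S y)"
proof -
  have "\<forall>a\<in>S_integers S. \<psi> (diag S (a * (x - y))) = 1"
    using assms(3,4) unfolding conductor_S_integers_def by blast
  hence "\<psi> (diag S (x - y)) = 1" using one_closed by force
  moreover have "\<psi> (diag S ((x - y) + y)) = \<psi> (diag S (x - y)) * \<psi> (diag S y)"
    using assms(1,2) diag_closed[OF assms(1)] diag_add[OF assms(1), of "x - y" y]
    unfolding additive_character_def by metis
  ultimately show ?thesis by simp
qed

section \<open>The change of variables\<close>

text \<open>The substitution multiplies \<open>c\<^sub>k\<close> by \<open>M\<^sub>k = w\<^sub>1 \<cdots> w\<^sub>k\<close>, where \<open>w\<^sub>l = m'\<^sub>l\<close> for \<open>l \<le> r\<close> and the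
  sequence then runs back, \<open>w\<^bsub>r+1\<^esub> = m'\<^sub>r\<close>, \<open>w\<^bsub>r+2\<^esub> = m'\<^bsub>r-1\<^esub>\<close>, \<dots>, \<open>w\<^bsub>2r-1\<^esub> = m'\<^sub>2\<close>. In this way
  each factor \<open>m'\<^bsub>j+1\<^esub>\<close> in the argument of \<open>\<psi>\<close> is the quotient of the multipliers of the two
  residues that occur next to it. Here \<open>w\<close> is \<open>scale_step\<close> and \<open>M\<close> is \<open>scale_factor\<close>.\<close>

definition scale_step :: "nat \<Rightarrow> (nat \<Rightarrow> 'a::field) \<Rightarrow> nat \<Rightarrow> 'a" where
  "scale_step r m' l = (if l \<le> r then m' l else m' (2 * r - l + 1))"

text \<open>The multiplier \<open>M\<^sub>k\<close> of the residue \<open>c\<^sub>k\<close>.\<close>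

definition scale_factor :: "nat \<Rightarrow> (nat \<Rightarrow> 'a::field) \<Rightarrow> nat \<Rightarrow> 'a" where
  "scale_factor r m' k = (\<Prod>l=1..k. scale_step r m' l)"

lemma scale_step_eq:
  assumes "1 \<le> l" "l \<le> 2 * r - 1"
  obtains i where "i \<in> {1..r}" "scale_step r m' l = m' i"
proof (cases "l \<le> r")
  case True
  thus ?thesis using that[of l] assms by (simp add: scale_step_def)
next
  case False
  hence "2 * r - l + 1 \<in> {1..r}" using assms by auto
  thus ?thesis using that[of "2 * r - l + 1"] False by (simp add: scale_step_def)
qed

lemma scale_one: "r \<ge> 1 \<Longrightarrow> scale_factor r m' (Suc 0) = m' (Suc 0)"
  by (simp add: scale_factor_def scale_step_def)

lemma scale_Suc_lower: "j + 1 \<le> r \<Longrightarrow> scale_factor r m' (j + 1) = m' (j + 1) * scale_factor r m' j"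
  by (simp add: scale_factor_def scale_step_def)

lemma scale_Suc_upper:
  assumes "1 \<le> j" "j < r"
  shows "scale_factor r m' (2 * r - j) = m' (j + 1) * scale_factor r m' (2 * r - 1 - j)"
proof -
  have "2 * r - j = Suc (2 * r - 1 - j)" using assms by simp
  moreover have "scale_step r m' (2 * r - j) = m' (j + 1)"
  proof -
    have "\<not> 2 * r - j \<le> r" "2 * r - (2 * r - j) + 1 = j + 1" using assms by linarith+
    thus ?thesis unfolding scale_step_def by presburger
  qed
  ultimately show ?thesis by (simp add: scale_factor_def)
qed

text \<open>Raised to the power \<open>eps r i\<close>, \<open>frakd\<close> has a description uniform in \<open>i\<close>: the exponent of \<open>d\<^sub>k\<close> is the
  number of \<open>l \<le> k\<close> with \<open>w\<^sub>l = m'\<^sub>i\<close>, doubled if \<open>k = r\<close> because the symbol of \<open>c\<^sub>r\<close> occurs twice.\<close>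

lemma frakd_power_eps:
  assumes "1 \<le> i" "i \<le> r"
  shows "frakd r d i ^ eps r i =
    (\<Prod>k=i..2*r-1. d k) * d r * (\<Prod>k=2*r-i+1..2*r-1. d k)"
proof (cases "i = r")
  case True
  have "{r..2*r-1} = insert r {r+1..2*r-1}" using assms by auto
  hence "(\<Prod>k=r..2*r-1. d k) = d r * (\<Prod>k=r+1..2*r-1. d k)" by simp
  thus ?thesis using True by (simp add: frakd_def eps_def power2_eq_square mult_2 algebra_simps)
next
  case False
  have "{i..2*r-1} = {i..r-1} \<union> ({r} \<union> ({r+1..2*r-i} \<union> {2*r-i+1..2*r-1}))"
    using assms False by auto
  moreover have "prod d ({i..r-1} \<union> ({r} \<union> ({r+1..2*r-i} \<union> {2*r-i+1..2*r-1}))) =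
      prod d {i..r-1} * (d r * (prod d {r+1..2*r-i} * prod d {2*r-i+1..2*r-1}))"
    using assms False by (subst prod.union_disjoint; (subst prod.union_disjoint)?; (subst prod.union_disjoint)?) auto
  ultimately show ?thesis using False
    by (simp add: frakd_def eps_def power2_eq_square prod.distrib algebra_simps)
qed

lemma prod_double_range:
  fixes f :: "nat \<Rightarrow> 'b::comm_monoid_mult"
  assumes "r \<ge> 1"
  shows "(\<Prod>i=1..r. f i * f (2*r-i)) = (\<Prod>k=1..2*r-1. f k) * f r"
proof -
  have "(\<Prod>i=1..r. f (2*r-i)) = (\<Prod>k=r..2*r-1. f k)"
    by (rule prod.reindex_bij_witness[where i = "\<lambda>k. 2*r-k" and j = "\<lambda>i. 2*r-i"])
       (use assms in auto)
  also have "{r..2*r-1} = insert r {r+1..2*r-1}" using assms by auto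
  also have "prod f \<dots> = f r * (\<Prod>k=r+1..2*r-1. f k)" by simp
  finally have 1: "(\<Prod>i=1..r. f (2*r-i)) = f r * (\<Prod>k=r+1..2*r-1. f k)" .
  have "{1..2*r-1} = {1..r} \<union> {r+1..2*r-1}" using assms by auto
  hence 2: "(\<Prod>k=1..2*r-1. f k) = (\<Prod>k=1..r. f k) * (\<Prod>k=r+1..2*r-1. f k)"
    by (simp add: prod.union_disjoint)
  show ?thesis unfolding prod.distrib 1 2 by (simp only: ac_simps)
qed

text \<open>Interchange of the two products over \<open>1 \<le> l \<le> k \<le> 2r-1\<close>; the two values of \<open>l\<close> with
  \<open>w\<^sub>l = m'\<^sub>i\<close> are \<open>i\<close> and, if \<open>i \<ge> 2\<close>, \<open>2r-i+1\<close>.\<close>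

lemma prod_scale_rearrange:
  fixes g :: "'a::field \<Rightarrow> 'a \<Rightarrow> 'b::comm_monoid_mult"
  assumes "r \<ge> 1"
  shows "(\<Prod>k=1..2*r-1. \<Prod>l=1..k. g (scale_step r m' l) (d k)) =
    (\<Prod>i=1..r. (\<Prod>k=i..2*r-1. g (m' i) (d k)) * (\<Prod>k=2*r-i+1..2*r-1. g (m' i) (d k)))"
proof -
  let ?N = "2*r-1"
  have "(\<Prod>k=1..?N. \<Prod>l=1..k. g (scale_step r m' l) (d k)) =
      (\<Prod>k=1..?N. \<Prod>l\<in>{l\<in>{1..?N}. l \<le> k}. g (scale_step r m' l) (d k))"
    by (intro prod.cong refl) auto
  also have "\<dots> = (\<Prod>l=1..?N. \<Prod>k\<in>{k\<in>{1..?N}. l \<le> k}. g (scale_step r m' l) (d k))"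
    by (rule prod.swap_restrict) auto
  also have "\<dots> = (\<Prod>l=1..?N. \<Prod>k=l..?N. g (scale_step r m' l) (d k))"
    by (intro prod.cong refl) auto
  also have "\<dots> = (\<Prod>l\<in>{1..r} \<union> {r+1..?N}. \<Prod>k=l..?N. g (scale_step r m' l) (d k))"
    using assms by (intro prod.cong refl) auto
  also have "\<dots> =
      (\<Prod>l=1..r. \<Prod>k=l..?N. g (scale_step r m' l) (d k)) *
      (\<Prod>l=r+1..?N. \<Prod>k=l..?N. g (scale_step r m' l) (d k))"
    by (rule prod.union_disjoint) auto
  also have "(\<Prod>l=1..r. \<Prod>k=l..?N. g (scale_step r m' l) (d k)) = (\<Prod>i=1..r. \<Prod>k=i..?N. g (m' i) (d k))"
    by (intro prod.cong refl) (simp add: scale_step_def)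
  also have "(\<Prod>l=r+1..?N. \<Prod>k=l..?N. g (scale_step r m' l) (d k)) =
      (\<Prod>i=2..r. \<Prod>k=2*r-i+1..?N. g (m' i) (d k))"
    by (rule prod.reindex_bij_witness[where i = "\<lambda>i. 2*r-i+1" and j = "\<lambda>l. 2*r-l+1"])
       (auto simp: scale_step_def)
  \<comment> \<open>The factor for \<open>i = 1\<close> is an empty product.\<close>
  also have "\<dots> = (\<Prod>i=1..r. \<Prod>k=2*r-i+1..?N. g (m' i) (d k))"
  proof -
    have "{1..r} = insert 1 {2..r}" using assms by auto
    thus ?thesis using assms by simp
  qed
  finally show ?thesis by (simp add: prod.distrib)
qed

context residue_symbols
begin

lemma residue_symbol_power_bottom:
  assumes "d \<in> S_integers S - {0}"
  shows "residue_symbol S \<epsilon> n c (d ^ k) = residue_symbol S \<epsilon> n c d ^ k"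
  using residue_symbol_prod_bottom[of "{..<k}" "\<lambda>_. d" c] assms by simp

lemma scale_closed:
  assumes "\<And>i. i \<in> {1..r} \<Longrightarrow> m' i \<in> S_integers S" "k \<le> 2 * r - 1"
  shows "scale_factor r m' k \<in> S_integers S"
  unfolding scale_factor_def
proof (rule prod_closed)
  fix l assume "l \<in> {1..k}"
  hence "1 \<le> l" "l \<le> 2 * r - 1" using assms(2) by auto
  then obtain i where "i \<in> {1..r}" "scale_step r m' l = m' i" by (rule scale_step_eq)
  thus "scale_step r m' l \<in> S_integers S" using assms(1) by simp
qed

lemma scale_coprime:
  assumes "\<And>i. i \<in> {1..r} \<Longrightarrow> m' i \<in> S_integers S \<and> coprime_S S (m' i) e"
    and "e \<in> S_integers S" "k \<le> 2 * r - 1"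
  shows "coprime_S S (scale_factor r m' k) e"
  unfolding scale_factor_def
proof (rule coprime_S_prod_left[OF _ assms(2)])
  fix l assume l: "l \<in> {1..k}"
  have "1 \<le> l" "l \<le> 2 * r - 1" using l assms(3) by auto
  then obtain i where "i \<in> {1..r}" "scale_step r m' l = m' i" by (rule scale_step_eq)
  thus "scale_step r m' l \<in> S_integers S \<and> coprime_S S (scale_step r m' l) e" using assms(1) by simp
qed

lemma frakd_closed:
  assumes d: "\<And>k. k \<in> {1..2*r-1} \<Longrightarrow> d k \<in> S_integers S - {0}" and i: "1 \<le> i" "i \<le> r"
  shows "frakd r d i \<in> S_integers S - {0}"
proof -
  have P: "prod d I \<in> S_integers S \<and> prod d I \<noteq> 0" if "I \<subseteq> {1..2*r-1}" for I
    using that d finite_subset[OF that] by (auto intro!: prod_closed)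
  have sq: "(\<Prod>k\<in>I. d k ^ 2) = prod d I ^ 2" for I by (simp add: prod_power_distrib)
  have "d r \<in> S_integers S" "d r \<noteq> 0" using d[of r] i by auto
  moreover have "{r..2*r-1} \<subseteq> {1..2*r-1}" "{i..r-1} \<subseteq> {1..2*r-1}" "{r+1..2*r-i} \<subseteq> {1..2*r-1}"
    "{2*r-i+1..2*r-1} \<subseteq> {1..2*r-1}" using i by auto
  note this[THEN P]
  ultimately show ?thesis unfolding frakd_def sq by (simp del: prod_zero_iff One_nat_def)
qed

text \<open>The residue symbols that the substitution produces. This is where the exponents
  \<open>eps r i\<close> come from.\<close>

lemma residue_symbol_scale_prod:
  assumes r: "r \<ge> 1"
    and d: "\<And>k. k \<in> {1..2*r-1} \<Longrightarrow> d k \<in> S_integers S - {0}"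
    and m': "\<And>i. i \<in> {1..r} \<Longrightarrow> m' i \<in> S_integers S"
  shows "(\<Prod>i=1..r. residue_symbol S \<epsilon> n (scale_factor r m' i) (d i)
             * residue_symbol S \<epsilon> n (scale_factor r m' (2*r-i)) (d (2*r-i))) =
         (\<Prod>i=1..r. residue_symbol S \<epsilon> n (m' i) (frakd r d i) ^ eps r i)"
proof -
  let ?X = "residue_symbol S \<epsilon> n"
  have step: "?X (scale_factor r m' k) (d k) = (\<Prod>l=1..k. ?X (scale_step r m' l) (d k))"
    if "k \<in> {1..2*r-1}" for k
    unfolding scale_factor_def
  proof (rule residue_symbol_prod_top[OF _ _ d[OF that]])
    fix l assume "l \<in> {1..k}"
    hence "1 \<le> l" "l \<le> 2 * r - 1" using that by auto
    then obtain i where "i \<in> {1..r}" "scale_step r m' l = m' i" by (rule scale_step_eq)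
    thus "scale_step r m' l \<in> S_integers S" using m' by simp
  qed simp
  have "(\<Prod>i=1..r. ?X (scale_factor r m' i) (d i) * ?X (scale_factor r m' (2*r-i)) (d (2*r-i))) =
      (\<Prod>k=1..2*r-1. ?X (scale_factor r m' k) (d k)) * ?X (scale_factor r m' r) (d r)"
    by (rule prod_double_range[OF r])
  also have "(\<Prod>k=1..2*r-1. ?X (scale_factor r m' k) (d k)) =
      (\<Prod>k=1..2*r-1. \<Prod>l=1..k. ?X (scale_step r m' l) (d k))"
    by (intro prod.cong refl step)
  also have "\<dots> = (\<Prod>i=1..r. (\<Prod>k=i..2*r-1. ?X (m' i) (d k)) * (\<Prod>k=2*r-i+1..2*r-1. ?X (m' i) (d k)))"
    by (rule prod_scale_rearrange[OF r])
  also have "?X (scale_factor r m' r) (d r) = (\<Prod>i=1..r. ?X (m' i) (d r))"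
    using step[of r] r by (simp add: scale_step_def)
  also have "(\<Prod>i=1..r. (\<Prod>k=i..2*r-1. ?X (m' i) (d k)) * (\<Prod>k=2*r-i+1..2*r-1. ?X (m' i) (d k))) *
      (\<Prod>i=1..r. ?X (m' i) (d r)) =
      (\<Prod>i=1..r. (\<Prod>k=i..2*r-1. ?X (m' i) (d k)) * ?X (m' i) (d r) *
                 (\<Prod>k=2*r-i+1..2*r-1. ?X (m' i) (d k)))"
    by (simp add: prod.distrib mult.commute mult.left_commute)
  also have "\<dots> = (\<Prod>i=1..r. ?X (m' i) (frakd r d i) ^ eps r i)"
  proof (rule prod.cong[OF refl])
    fix i assume i: "i \<in> {1..r}"
    have P: "prod d I \<in> S_integers S - {0}" "?X c (prod d I) = (\<Prod>k\<in>I. ?X c (d k))"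
      if "I \<subseteq> {1..2*r-1}" for I c
      using that d finite_subset[OF that]
      by (auto intro!: prod_closed residue_symbol_prod_bottom)
    have sub: "{i..2*r-1} \<subseteq> {1..2*r-1}" "{2*r-i+1..2*r-1} \<subseteq> {1..2*r-1}" using i by auto
    have dr: "d r \<in> S_integers S - {0}" using d[of r] r by simp
    have fr: "frakd r d i \<in> S_integers S - {0}"
      using i by (intro frakd_closed d) auto
    have "prod d {i..2*r-1} * d r \<in> S_integers S - {0}" using P(1)[OF sub(1)] dr by simp
    hence "?X (m' i) (prod d {i..2*r-1} * d r * prod d {2*r-i+1..2*r-1}) =
        (\<Prod>k=i..2*r-1. ?X (m' i) (d k)) * ?X (m' i) (d r) * (\<Prod>k=2*r-i+1..2*r-1. ?X (m' i) (d k))"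
      using residue_symbol_mult_bottom[OF _ P(1)[OF sub(2)]] residue_symbol_mult_bottom[OF P(1)[OF sub(1)] dr]
        P(2)[OF sub(1)] P(2)[OF sub(2)] by simp
    moreover have "frakd r d i ^ eps r i = prod d {i..2*r-1} * d r * prod d {2*r-i+1..2*r-1}"
      using i by (intro frakd_power_eps) auto
    ultimately show "(\<Prod>k=i..2*r-1. ?X (m' i) (d k)) * ?X (m' i) (d r) * (\<Prod>k=2*r-i+1..2*r-1. ?X (m' i) (d k)) =
        ?X (m' i) (frakd r d i) ^ eps r i"
      using residue_symbol_power_bottom[OF fr, of "m' i" "eps r i"] by metis
  qed
  finally show ?thesis .
qed

end

text \<open>Both kinds of terms in the argument of \<open>\<psi>\<close> have the shape \<open>a u c / q\<close>, where \<open>c\<close> matters modulo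
  \<open>q\<close> and \<open>u\<close> modulo a \<open>p\<close> such that \<open>a p / q\<close> is integral. In the substitution \<open>c\<close> gains the
  multiplier \<open>\<mu> M\<close> and \<open>u\<close> loses the multiplier \<open>M\<close>, so that the factor \<open>\<mu>\<close> appears.\<close>

lemma (in pid_S_integers) phase_congruence:
  assumes a: "a \<in> S_integers S" "a * p / q \<in> S_integers S" and q: "q \<noteq> 0"
    and c: "q divides\<^bsub>\<oo> S\<^esub> (c - (\<mu> * M) * c')" and u: "p divides\<^bsub>\<oo> S\<^esub> (u' - M * u)"
    and mem: "u \<in> S_integers S" "c' \<in> S_integers S" "\<mu> \<in> S_integers S"
  shows "a * (u * c / q) - a * \<mu> * (u' * c' / q) \<in> S_integers S"
proof -
  obtain s where s: "s \<in> S_integers S" "c - (\<mu> * M) * c' = q * s" using c by (auto simp: divides_iff)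
  obtain t where t: "t \<in> S_integers S" "u' - M * u = p * t" using u by (auto simp: divides_iff)
  have c_eq: "c = (\<mu> * M) * c' + q * s" and u_eq: "u' = M * u + p * t"
    using s t by (simp_all add: algebra_simps)
  have "a * (u * c / q) - a * \<mu> * (u' * c' / q) = a * u * s - (a * p / q) * (\<mu> * c' * t)"
    unfolding c_eq u_eq using q by (simp add: field_simps)
  also have "\<dots> \<in> S_integers S" by (intro diff_closed mult_closed a mem s(1) t(1))
  finally show ?thesis .
qed

text \<open>The divisibility conditions on \<open>d\<close> make the argument of \<open>\<psi>\<close>, taken modulo \<open>S\<close>-integers,
  depend only on \<open>c\<^sub>k\<close> and \<open>u\<^sub>k\<close> modulo \<open>d\<^sub>k\<close>; so congruences \<open>c\<^sub>k \<equiv> M\<^sub>k c'\<^sub>k\<close> and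
  \<open>u'\<^sub>k \<equiv> M\<^sub>k u\<^sub>k\<close> suffice.\<close>

lemma (in pid_S_integers) psi_arg_scaled:
  assumes r: "r \<ge> 2"
    and d: "\<And>k. k \<in> {1..2*r-1} \<Longrightarrow> d k \<in> S_integers S - {0}"
    and m: "\<And>i. i \<in> {1..r} \<Longrightarrow> m i \<in> S_integers S"
    and m': "\<And>i. i \<in> {1..r} \<Longrightarrow> m' i \<in> S_integers S"
    and c': "\<And>k. k \<in> {1..2*r-1} \<Longrightarrow> c' k \<in> S_integers S"
    and u: "\<And>k. k \<in> {1..2*r-1} \<Longrightarrow> u k \<in> S_integers S"
    and dvd1: "\<And>j. j \<in> {1..r-1} \<Longrightarrow> d (j+1) divides\<^bsub>\<oo> S\<^esub> (m (j+1) * d j)"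
    and dvd2: "\<And>j. j \<in> {1..r-2} \<Longrightarrow> (d (j+1) * d (2*r-j)) divides\<^bsub>\<oo> S\<^esub> (m (j+1) * d j * d (2*r-j-1))"
    and dvd3: "d (r+1) divides\<^bsub>\<oo> S\<^esub> (m r * d (r-1))"
    and c: "\<And>k. k \<in> {1..2*r-1} \<Longrightarrow> d k divides\<^bsub>\<oo> S\<^esub> (c k - scale_factor r m' k * c' k)"
    and u': "\<And>k. k \<in> {1..2*r-1} \<Longrightarrow> d k divides\<^bsub>\<oo> S\<^esub> (u' k - scale_factor r m' k * u k)"
  shows "psi_arg r m d c u - psi_arg r (\<lambda>i. m i * m' i) d c' u' \<in> S_integers S"
proof -
  have first: "m 1 * (c 1 / d 1) - m 1 * m' 1 * (c' 1 / d 1) \<in> S_integers S"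
  proof -
    have 1: "1 \<in> {1..2*r-1}" "1 \<in> {1..r}" using r by auto
    obtain s where s: "s \<in> S_integers S" "c 1 - scale_factor r m' 1 * c' 1 = d 1 * s"
      using c[OF 1(1)] by (auto simp: divides_iff)
    hence "c 1 = m' 1 * c' 1 + d 1 * s" using r scale_one[of r m'] by (simp add: algebra_simps)
    hence "m 1 * (c 1 / d 1) - m 1 * m' 1 * (c' 1 / d 1) = m 1 * s"
      using d[OF 1(1)] by (simp add: field_simps)
    thus ?thesis using m[OF 1(2)] s by simp
  qed
  have lower: "m (j+1) * (u j * c (j+1) / d (j+1)) - m (j+1) * m' (j+1) * (u' j * c' (j+1) / d (j+1)) \<in> S_integers S"
    if j: "j \<in> {1..r-1}" for j
  proof (rule phase_congruence)
    have jr: "j \<in> {1..2*r-1}" "j + 1 \<in> {1..2*r-1}" "j + 1 \<in> {1..r}" "j + 1 \<le> r" using j r by auto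
    show "m (j+1) \<in> S_integers S" "m' (j+1) \<in> S_integers S" using m m' jr by blast+
    show nz: "d (j+1) \<noteq> 0" using d jr by blast
    show "m (j+1) * d j / d (j+1) \<in> S_integers S"
      using dvd1[OF j] divides_iff_quotient[OF nz] by blast
    show "d (j+1) divides\<^bsub>\<oo> S\<^esub> (c (j+1) - (m' (j+1) * scale_factor r m' j) * c' (j+1))"
      using c[OF jr(2)] scale_Suc_lower[OF jr(4), of m'] by simp
    show "d j divides\<^bsub>\<oo> S\<^esub> (u' j - scale_factor r m' j * u j)" using u'[OF jr(1)] .
    show "u j \<in> S_integers S" "c' (j+1) \<in> S_integers S" using u c' jr by blast+
  qed
  have upper: "m (j+1) * d j / d (j+1) * (u (2*r-1-j) * c (2*r-j) / d (2*r-j))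
      - m (j+1) * d j / d (j+1) * m' (j+1) * (u' (2*r-1-j) * c' (2*r-j) / d (2*r-j)) \<in> S_integers S"
    if j: "j \<in> {1..r-1}" for j
  proof (rule phase_congruence)
    have jr: "j \<in> {1..2*r-1}" "j + 1 \<in> {1..2*r-1}" "j + 1 \<in> {1..r}" "1 \<le> j" "j < r"
      "2*r-j \<in> {1..2*r-1}" "2*r-1-j \<in> {1..2*r-1}" using j r by auto
    have nz: "d (j+1) \<noteq> 0" using d jr by blast
    show "m (j+1) * d j / d (j+1) \<in> S_integers S"
      using dvd1[OF j] divides_iff_quotient[OF nz] by blast
    show "m' (j+1) \<in> S_integers S" using m' jr by blast
    show nz2: "d (2*r-j) \<noteq> 0" using d jr by blast
    show "m (j+1) * d j / d (j+1) * d (2*r-1-j) / d (2*r-j) \<in> S_integers S"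
    proof (cases "j = r - 1")
      case True
      have "j + 1 = r" "2*r-1-j = r" "2*r-j = r+1" using True r by auto
      thus ?thesis using dvd3 nz nz2 True divides_iff_quotient[of "d (r+1)" "m r * d (r-1)"] by simp
    next
      case False
      hence "j \<in> {1..r-2}" using j by auto
      from dvd2[OF this] have "m (j+1) * d j * d (2*r-j-1) / (d (j+1) * d (2*r-j)) \<in> S_integers S"
        using nz nz2 divides_iff_quotient[of "d (j+1) * d (2*r-j)"] by simp
      moreover have "2*r-j-1 = 2*r-1-j" by simp
      ultimately show ?thesis by (simp add: mult.assoc)
    qed
    show "d (2*r-j) divides\<^bsub>\<oo> S\<^esub> (c (2*r-j) - (m' (j+1) * scale_factor r m' (2*r-1-j)) * c' (2*r-j))"
      using c[OF jr(6)] scale_Suc_upper[OF jr(4,5), of m'] by simp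
    show "d (2*r-1-j) divides\<^bsub>\<oo> S\<^esub> (u' (2*r-1-j) - scale_factor r m' (2*r-1-j) * u (2*r-1-j))" using u'[OF jr(7)] .
    show "u (2*r-1-j) \<in> S_integers S" "c' (2*r-j) \<in> S_integers S" using u c' jr by blast+
  qed
  define A where "A j = m (j+1) * (u j * c (j+1) / d (j+1)) - m (j+1) * m' (j+1) * (u' j * c' (j+1) / d (j+1))" for j
  define B where "B j = m (j+1) * d j / d (j+1) * (u (2*r-1-j) * c (2*r-j) / d (2*r-j))
      - m (j+1) * d j / d (j+1) * m' (j+1) * (u' (2*r-1-j) * c' (2*r-j) / d (2*r-j))" for j
  have "psi_arg r m d c u - psi_arg r (\<lambda>i. m i * m' i) d c' u' =
      (m 1 * (c 1 / d 1) - m 1 * m' 1 * (c' 1 / d 1)) + (\<Sum>j=1..r-1. A j + (-1) ^ eps r (j+1) * B j)"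
  proof -
    have "(\<Sum>j=1..r-1. A j + (-1) ^ eps r (j+1) * B j) =
        (\<Sum>j=1..r-1. m (j+1) * (u j * c (j+1) / d (j+1)
           + (-1) ^ eps r (j+1) * (d j * c (2*r-j) * u (2*r-1-j) / (d (j+1) * d (2*r-j))))
         - m (j+1) * m' (j+1) * (u' j * c' (j+1) / d (j+1)
           + (-1) ^ eps r (j+1) * (d j * c' (2*r-j) * u' (2*r-1-j) / (d (j+1) * d (2*r-j)))))"
      by (intro sum.cong refl) (simp add: A_def B_def algebra_simps)
    thus ?thesis by (simp add: psi_arg_def sum_subtractf)
  qed
  also have "\<dots> \<in> S_integers S"
    using first lower upper by (intro add_closed sum_closed mult_closed power_closed) (auto simp: A_def B_def)
  finally show ?thesis .
qed

section \<open>Twisted multiplicativity\<close>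

text \<open>The data that enter the coefficients; the entries of \<open>d\<close> and \<open>D\<close> are taken from the set \<open>R\<close>
  of nonzero \<open>S\<close>-integers.\<close>

locale H_setting = residue_symbols S n \<epsilon>
  for S :: "('a::field_char_0 \<Rightarrow> real) set" and n :: nat and \<epsilon> :: "'a \<Rightarrow> complex" +
  fixes \<psi> :: "(('a \<Rightarrow> real) \<Rightarrow> (nat \<Rightarrow> 'a) set) \<Rightarrow> complex" and R :: "'a set"
  assumes places: "\<forall>v\<in>S. place v"
    and character: "additive_character S \<psi>" "conductor_S_integers S \<psi>"
    and R_subset: "R \<subseteq> S_integers S - {0}"
begin

lemma H_rank_one:
  assumes C: "C \<in> S_integers S - {0}" and m: "m \<in> S_integers S"
    and m': "m' \<in> S_integers S" "coprime_S S m' C"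
  shows "(\<Sum>c\<in>reduced_residues S C. residue_symbol S \<epsilon> n c C ^ 2 * \<psi> (diag S (m * c / C))) =
    residue_symbol S \<epsilon> n m' C ^ 2 *
    (\<Sum>c\<in>reduced_residues S C. residue_symbol S \<epsilon> n c C ^ 2 * \<psi> (diag S (m * m' * c / C)))"
proof -
  have CO: "C \<in> S_integers S" "C \<noteq> 0" using C by auto
  obtain f where bij: "bij_betw f (reduced_residues S C) (reduced_residues S C)"
    and f: "\<And>c. c \<in> reduced_residues S C \<Longrightarrow> C divides\<^bsub>\<oo> S\<^esub> (f c - m' * c)"
    using bij_betw_scale_reduced_residues[OF CO(1) m'] by blast
  have "(\<Sum>c\<in>reduced_residues S C. residue_symbol S \<epsilon> n c C ^ 2 * \<psi> (diag S (m * c / C))) =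
      (\<Sum>c\<in>reduced_residues S C. residue_symbol S \<epsilon> n (f c) C ^ 2 * \<psi> (diag S (m * f c / C)))"
    by (rule sum.reindex_bij_betw[OF bij, symmetric])
  also have "\<dots> = (\<Sum>c\<in>reduced_residues S C. residue_symbol S \<epsilon> n m' C ^ 2 *
      (residue_symbol S \<epsilon> n c C ^ 2 * \<psi> (diag S (m * m' * c / C))))"
  proof (rule sum.cong[OF refl])
    fix c assume c: "c \<in> reduced_residues S C"
    have cO: "c \<in> S_integers S" "f c \<in> S_integers S"
      using reduced_residues_mem(1)[OF CO(1)] c bij_betwE[OF bij] by blast+
    have "residue_symbol S \<epsilon> n (f c) C = residue_symbol S \<epsilon> n m' C * residue_symbol S \<epsilon> n c C"
      using residue_symbol_cong[OF f[OF c] cO(2) mult_closed[OF m'(1) cO(1)] C]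
        residue_symbol_mult_top[OF m'(1) cO(1) C] by simp
    moreover have "\<psi> (diag S (m * f c / C)) = \<psi> (diag S (m * m' * c / C))"
    proof (rule additive_character_cong[OF places character])
      have "(f c - m' * c) / C \<in> S_integers S" using f[OF c] divides_iff_quotient[OF CO(2)] by blast
      hence "m * ((f c - m' * c) / C) \<in> S_integers S" by (rule mult_closed[OF m])
      thus "m * f c / C - m * m' * c / C \<in> S_integers S" using CO by (simp add: field_simps)
    qed
    ultimately show "residue_symbol S \<epsilon> n (f c) C ^ 2 * \<psi> (diag S (m * f c / C)) =
        residue_symbol S \<epsilon> n m' C ^ 2 * (residue_symbol S \<epsilon> n c C ^ 2 * \<psi> (diag S (m * m' * c / C)))"
      by (simp add: power_mult_distrib)
  qed
  finally show ?thesis by (simp add: sum_distrib_left)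
qed

text \<open>The sum over \<open>c\<close> for fixed \<open>d\<close>, after the substitution \<open>c\<^sub>k \<mapsto> M\<^sub>k c\<^sub>k\<close>.\<close>

lemma inner_sum_scaled:
  assumes r: "r \<ge> 2"
    and d: "\<And>k. k \<in> {1..2*r-1} \<Longrightarrow> d k \<in> S_integers S - {0}"
    and m: "\<And>i. i \<in> {1..r} \<Longrightarrow> m i \<in> S_integers S"
    and m': "\<And>i. i \<in> {1..r} \<Longrightarrow> m' i \<in> S_integers S"
    and cop: "\<And>i k. i \<in> {1..r} \<Longrightarrow> k \<in> {1..2*r-1} \<Longrightarrow> coprime_S S (m' i) (d k)"
    and dvd1: "\<And>j. j \<in> {1..r-1} \<Longrightarrow> d (j+1) divides\<^bsub>\<oo> S\<^esub> (m (j+1) * d j)"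
    and dvd2: "\<And>j. j \<in> {1..r-2} \<Longrightarrow> (d (j+1) * d (2*r-j)) divides\<^bsub>\<oo> S\<^esub> (m (j+1) * d j * d (2*r-j-1))"
    and dvd3: "d (r+1) divides\<^bsub>\<oo> S\<^esub> (m r * d (r-1))"
  shows "(\<Sum>c\<in>(\<Pi>\<^sub>E i\<in>{1..2*r-1}. reduced_residues S (d i)).
      (\<Prod>i=1..r. residue_symbol S \<epsilon> n (c i) (d i) * residue_symbol S \<epsilon> n (c (2*r-i)) (d (2*r-i)))
      * \<psi> (diag S (psi_arg r m d c (\<lambda>i. inv_mod S (c i) (d i))))) =
    (\<Prod>i=1..r. residue_symbol S \<epsilon> n (m' i) (frakd r d i) ^ eps r i) *
    (\<Sum>c\<in>(\<Pi>\<^sub>E i\<in>{1..2*r-1}. reduced_residues S (d i)).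
      (\<Prod>i=1..r. residue_symbol S \<epsilon> n (c i) (d i) * residue_symbol S \<epsilon> n (c (2*r-i)) (d (2*r-i)))
      * \<psi> (diag S (psi_arg r (\<lambda>i. m i * m' i) d c (\<lambda>i. inv_mod S (c i) (d i)))))"
    (is "sum ?F ?A = ?K * sum ?G ?A")
proof -
  let ?I = "{1..2*r-1}"
  let ?X = "residue_symbol S \<epsilon> n"
  let ?M = "scale_factor r m'"
  have MO: "?M k \<in> S_integers S" "coprime_S S (?M k) (d k)" if k: "k \<in> ?I" for k
  proof -
    have k2: "k \<le> 2*r-1" using k by simp
    show "?M k \<in> S_integers S" by (rule scale_closed[OF m' k2])
    show "coprime_S S (?M k) (d k)"
    proof (rule scale_coprime[OF _ _ k2])
      show "d k \<in> S_integers S" using d[OF k] by simp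
      show "m' i \<in> S_integers S \<and> coprime_S S (m' i) (d k)" if "i \<in> {1..r}" for i
        using m'[OF that] cop[OF that k] by blast
    qed
  qed
  have "\<forall>k\<in>?I. \<exists>f. bij_betw f (reduced_residues S (d k)) (reduced_residues S (d k)) \<and>
      (\<forall>c\<in>reduced_residues S (d k). d k divides\<^bsub>\<oo> S\<^esub> (f c - ?M k * c))"
  proof
    fix k assume k: "k \<in> ?I"
    have "d k \<in> S_integers S" using d[OF k] by simp
    then obtain f where "bij_betw f (reduced_residues S (d k)) (reduced_residues S (d k))"
      "\<And>c. c \<in> reduced_residues S (d k) \<Longrightarrow> d k divides\<^bsub>\<oo> S\<^esub> (f c - ?M k * c)"
      using bij_betw_scale_reduced_residues MO[OF k] by blast
    thus "\<exists>f. bij_betw f (reduced_residues S (d k)) (reduced_residues S (d k)) \<and>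
      (\<forall>c\<in>reduced_residues S (d k). d k divides\<^bsub>\<oo> S\<^esub> (f c - ?M k * c))" by blast
  qed
  from bchoice[OF this] obtain f where
    f: "\<And>k. k \<in> ?I \<Longrightarrow> bij_betw (f k) (reduced_residues S (d k)) (reduced_residues S (d k))"
      "\<And>k c. k \<in> ?I \<Longrightarrow> c \<in> reduced_residues S (d k) \<Longrightarrow> d k divides\<^bsub>\<oo> S\<^esub> (f k c - ?M k * c)"
    by blast
  define g where "g c = (\<lambda>k\<in>?I. f k (c k))" for c
  have bij: "bij_betw g ?A ?A"
    unfolding g_def by (rule bij_betw_PiE_componentwise[OF f(1)])
  have "sum ?F ?A = (\<Sum>c\<in>?A. ?F (g c))"
    by (rule sum.reindex_bij_betw[OF bij, symmetric])
  also have "\<dots> = (\<Sum>c\<in>?A. ?K * ?G c)"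
  proof (rule sum.cong[OF refl])
    fix c assume c: "c \<in> ?A"
    have gc: "g c \<in> ?A" using bij_betwE[OF bij] c by blast
    have rr: "c k \<in> reduced_residues S (d k)" "g c k \<in> reduced_residues S (d k)" if "k \<in> ?I" for k
      using PiE_mem[OF c that] PiE_mem[OF gc that] by blast+
    have dO: "d k \<in> S_integers S" if "k \<in> ?I" for k using d[OF that] by simp
    have cO: "c k \<in> S_integers S" "coprime_S S (c k) (d k)"
      "g c k \<in> S_integers S" "coprime_S S (g c k) (d k)" if "k \<in> ?I" for k
      using reduced_residues_mem[OF dO[OF that]] rr[OF that] by blast+
    have dvd: "d k divides\<^bsub>\<oo> S\<^esub> (g c k - ?M k * c k)" if "k \<in> ?I" for k
      using f(2)[OF that rr(1)[OF that]] that by (simp add: g_def)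
    have inv: "inv_mod S (c k) (d k) \<in> S_integers S" "inv_mod S (g c k) (d k) \<in> S_integers S"
      "d k divides\<^bsub>\<oo> S\<^esub> (inv_mod S (c k) (d k) - ?M k * inv_mod S (g c k) (d k))" if k: "k \<in> ?I" for k
      using inv_mod(1)[OF cO(2)[OF k] cO(1)[OF k] dO[OF k]] inv_mod(1)[OF cO(4)[OF k] cO(3)[OF k] dO[OF k]]
        inv_mod_scaled[OF dvd[OF k] cO(4)[OF k] cO(2)[OF k] cO(3)[OF k] cO(1)[OF k] MO(1)[OF k] dO[OF k]]
      by blast+
    have "\<psi> (diag S (psi_arg r m d (g c) (\<lambda>i. inv_mod S (g c i) (d i)))) =
        \<psi> (diag S (psi_arg r (\<lambda>i. m i * m' i) d c (\<lambda>i. inv_mod S (c i) (d i))))"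
      by (rule additive_character_cong[OF places character],
          rule psi_arg_scaled[OF r d m m' cO(1) inv(2) dvd1 dvd2 dvd3 dvd inv(3)])
    moreover have sym: "?X (g c k) (d k) = ?X (?M k) (d k) * ?X (c k) (d k)" if k: "k \<in> ?I" for k
      using residue_symbol_cong[OF dvd[OF k] cO(3)[OF k] mult_closed[OF MO(1)[OF k] cO(1)[OF k]] d[OF k]]
        residue_symbol_mult_top[OF MO(1)[OF k] cO(1)[OF k] d[OF k]] by simp
    have "(\<Prod>i=1..r. ?X (g c i) (d i) * ?X (g c (2*r-i)) (d (2*r-i))) =
        (\<Prod>i=1..r. ?X (?M i) (d i) * ?X (?M (2*r-i)) (d (2*r-i))) *
        (\<Prod>i=1..r. ?X (c i) (d i) * ?X (c (2*r-i)) (d (2*r-i)))"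
      unfolding prod.distrib[symmetric]
    proof (rule prod.cong[OF refl])
      fix i assume "i \<in> {1..r}"
      hence "i \<in> ?I" "2*r-i \<in> ?I" by auto
      thus "?X (g c i) (d i) * ?X (g c (2*r-i)) (d (2*r-i)) =
        (?X (?M i) (d i) * ?X (?M (2*r-i)) (d (2*r-i))) * (?X (c i) (d i) * ?X (c (2*r-i)) (d (2*r-i)))"
        by (simp only: sym ac_simps)
    qed
    moreover have "(\<Prod>i=1..r. ?X (?M i) (d i) * ?X (?M (2*r-i)) (d (2*r-i))) = ?K"
      using r by (intro residue_symbol_scale_prod d m') simp
    ultimately show "?F (g c) = ?K * ?G c" by (simp only: mult.assoc)
  qed
  finally show ?thesis by (simp only: sum_distrib_left)
qed

lemma H_index_facts:
  assumes r: "r \<ge> 2"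
    and d: "d \<in> {1..2*r-1} \<rightarrow>\<^sub>E R" and D: "D \<in> {2..r} \<rightarrow>\<^sub>E R"
    and C1: "C 1 \<sim>\<^bsub>\<oo> S\<^esub> frakd r d 1" and Ci: "\<forall>i\<in>{2..r}. C i \<sim>\<^bsub>\<oo> S\<^esub> frakd r d i * D i"
  shows "\<And>k. k \<in> {1..2*r-1} \<Longrightarrow> d k \<in> S_integers S - {0}"
    and "\<And>k. k \<in> {1..2*r-1} \<Longrightarrow> d k divides\<^bsub>\<oo> S\<^esub> C 1"
    and "\<And>i. i \<in> {2..r} \<Longrightarrow> D i \<in> S_integers S - {0}"
    and "\<And>i. i \<in> {2..r} \<Longrightarrow> D i divides\<^bsub>\<oo> S\<^esub> C i"
proof -
  show dO: "d k \<in> S_integers S - {0}" if "k \<in> {1..2*r-1}" for k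
    using PiE_mem[OF d that] R_subset by blast
  show DO: "D i \<in> S_integers S - {0}" if "i \<in> {2..r}" for i
    using PiE_mem[OF D that] R_subset by blast
  have dO': "d k \<in> S_integers S" if "k \<in> {1..2*r-1}" for k using dO[OF that] by blast
  show "d k divides\<^bsub>\<oo> S\<^esub> C 1" if k: "k \<in> {1..2*r-1}" for k
  proof -
    have "{2*r-1+1..2*r-1} = {}" "eps r 1 = 1" using r by (auto simp: eps_def)
    hence eq: "frakd r d 1 = (\<Prod>k=1..2*r-1. d k) * d r"
      using frakd_power_eps[of 1 r d] r by simp
    have "d k divides\<^bsub>\<oo> S\<^esub> (\<Prod>k=1..2*r-1. d k)"
      by (rule divides_prod[OF _ k dO']) simp
    moreover have "d r \<in> S_integers S" using r by (intro dO') auto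
    ultimately have "d k divides\<^bsub>\<oo> S\<^esub> frakd r d 1" unfolding eq by (rule divides_mult_right)
    thus ?thesis using C1 divides_trans unfolding associated_def by blast
  qed
  show "D i divides\<^bsub>\<oo> S\<^esub> C i" if i: "i \<in> {2..r}" for i
  proof -
    have "frakd r d i \<in> S_integers S - {0}" using i by (intro frakd_closed dO) auto
    hence "D i divides\<^bsub>\<oo> S\<^esub> (frakd r d i * D i)" by (auto simp: divides_iff mult.commute)
    thus ?thesis using Ci i divides_trans unfolding associated_def by blast
  qed
qed

text \<open>Every \<open>d\<^sub>k\<close> divides \<open>C\<^sub>1\<close>, hence is prime to every \<open>m'\<^sub>i\<close>, and the divisibility conditions do not
  see the twist.\<close>

lemma H_index_twist:
  assumes r: "r \<ge> 2"
    and m: "\<And>i. i \<in> {1..r} \<Longrightarrow> m i \<in> S_integers S"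
    and m': "\<And>i. i \<in> {1..r} \<Longrightarrow> m' i \<in> S_integers S"
    and cop: "\<And>i. i \<in> {1..r} \<Longrightarrow> coprime_S S (m' i) (C 1)"
  shows "H_index S R r C (\<lambda>i. m i * m' i) = H_index S R r C m"
proof -
  have "(\<forall>j\<in>{1..r-1}. d (j+1) divides\<^bsub>\<oo> S\<^esub> (m (j+1) * m' (j+1) * d j)) \<longleftrightarrow>
          (\<forall>j\<in>{1..r-1}. d (j+1) divides\<^bsub>\<oo> S\<^esub> (m (j+1) * d j))" (is ?A)
       "(\<forall>j\<in>{1..r-2}. (d (j+1) * d (2*r-j)) divides\<^bsub>\<oo> S\<^esub> (m (j+1) * m' (j+1) * d j * d (2*r-j-1))) \<longleftrightarrow>
          (\<forall>j\<in>{1..r-2}. (d (j+1) * d (2*r-j)) divides\<^bsub>\<oo> S\<^esub> (m (j+1) * d j * d (2*r-j-1)))" (is ?B)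
       "d (r+1) divides\<^bsub>\<oo> S\<^esub> (m r * m' r * d (r-1)) \<longleftrightarrow> d (r+1) divides\<^bsub>\<oo> S\<^esub> (m r * d (r-1))" (is ?C)
    if basic: "d \<in> {1..2*r-1} \<rightarrow>\<^sub>E R" "D \<in> {2..r} \<rightarrow>\<^sub>E R" "C 1 \<sim>\<^bsub>\<oo> S\<^esub> frakd r d 1"
        "\<forall>i\<in>{2..r}. C i \<sim>\<^bsub>\<oo> S\<^esub> frakd r d i * D i" for d D
  proof -
    note facts = H_index_facts[OF r basic]
    have dO: "d k \<in> S_integers S" if "k \<in> {1..2*r-1}" for k using facts(1)[OF that] by blast
    have m'd: "coprime_S S (m' i) (d k)" if "i \<in> {1..r}" "k \<in> {1..2*r-1}" for i k
    proof (rule coprime_S_divisors[OF cop[OF that(1)] _ facts(2)[OF that(2)] m'[OF that(1)] dO[OF that(2)]])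
      show "m' i divides\<^bsub>\<oo> S\<^esub> m' i" by (auto simp: divides_iff intro: bexI[of _ 1])
    qed
    have cancel: "e divides\<^bsub>\<oo> S\<^esub> (m i * m' i * x) \<longleftrightarrow> e divides\<^bsub>\<oo> S\<^esub> (m i * x)"
      if "i \<in> {1..r}" "coprime_S S (m' i) e" "e \<in> S_integers S" "x \<in> S_integers S" for i e x
    proof -
      have eq: "m i * m' i * x = (m i * x) * m' i" by simp
      show ?thesis unfolding eq
        by (rule coprime_S_divides_mult_iff[OF that(2) m'[OF that(1)] that(3) mult_closed[OF m[OF that(1)] that(4)]])
    qed
    show ?A
    proof (rule ball_cong[OF refl])
      fix j assume "j \<in> {1..r-1}"
      hence j: "j + 1 \<in> {1..r}" "j + 1 \<in> {1..2*r-1}" "j \<in> {1..2*r-1}" using r by auto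
      show "d (j+1) divides\<^bsub>\<oo> S\<^esub> (m (j+1) * m' (j+1) * d j) \<longleftrightarrow> d (j+1) divides\<^bsub>\<oo> S\<^esub> (m (j+1) * d j)"
        by (rule cancel[OF j(1) m'd[OF j(1,2)] dO[OF j(2)] dO[OF j(3)]])
    qed
    show ?B
    proof (rule ball_cong[OF refl])
      fix j assume "j \<in> {1..r-2}"
      hence j: "j + 1 \<in> {1..r}" "j + 1 \<in> {1..2*r-1}" "j \<in> {1..2*r-1}" "2*r-j \<in> {1..2*r-1}"
        "2*r-j-1 \<in> {1..2*r-1}" using r by auto
      have "coprime_S S (d (j+1) * d (2*r-j)) (m' (j+1))"
        using m'd[OF j(1,2)] m'd[OF j(1,4)] coprime_S_commute
        by (intro coprime_S_mult_left[OF _ _ dO[OF j(2)] dO[OF j(4)] m'[OF j(1)]]) blast+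
      hence "coprime_S S (m' (j+1)) (d (j+1) * d (2*r-j))" using coprime_S_commute by blast
      from cancel[OF j(1) this mult_closed[OF dO[OF j(2)] dO[OF j(4)]] mult_closed[OF dO[OF j(3)] dO[OF j(5)]]]
      show "(d (j+1) * d (2*r-j)) divides\<^bsub>\<oo> S\<^esub> (m (j+1) * m' (j+1) * d j * d (2*r-j-1)) \<longleftrightarrow>
          (d (j+1) * d (2*r-j)) divides\<^bsub>\<oo> S\<^esub> (m (j+1) * d j * d (2*r-j-1))"
        by (simp only: mult.assoc)
    qed
    have k: "r \<in> {1..r}" "r + 1 \<in> {1..2*r-1}" "r - 1 \<in> {1..2*r-1}" using r by auto
    show ?C by (rule cancel[OF k(1) m'd[OF k(1,2)] dO[OF k(2)] dO[OF k(3)]])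
  qed
  note iffs = this
  show ?thesis
  proof (rule Set.set_eqI)
    fix x :: "(nat \<Rightarrow> 'a) \<times> (nat \<Rightarrow> 'a)"
    obtain d D where x: "x = (d, D)" by (cases x)
    show "x \<in> H_index S R r C (\<lambda>i. m i * m' i) \<longleftrightarrow> x \<in> H_index S R r C m"
    proof (cases "d \<in> {1..2*r-1} \<rightarrow>\<^sub>E R \<and> D \<in> {2..r} \<rightarrow>\<^sub>E R \<and> C 1 \<sim>\<^bsub>\<oo> S\<^esub> frakd r d 1 \<and>
        (\<forall>i\<in>{2..r}. C i \<sim>\<^bsub>\<oo> S\<^esub> frakd r d i * D i)")
      case True
      hence basic: "d \<in> {1..2*r-1} \<rightarrow>\<^sub>E R" "D \<in> {2..r} \<rightarrow>\<^sub>E R" "C 1 \<sim>\<^bsub>\<oo> S\<^esub> frakd r d 1"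
        "\<forall>i\<in>{2..r}. C i \<sim>\<^bsub>\<oo> S\<^esub> frakd r d i * D i" by blast+
      show ?thesis unfolding x by (simp only: H_index_def mem_Collect_eq prod.case iffs[OF basic])
    next
      case False
      thus ?thesis unfolding x H_index_def mem_Collect_eq prod.case by blast
    qed
  qed
qed

lemma lower_m_closed:
  assumes r: "r \<ge> 2" and i: "i \<in> {2..r}"
    and d: "\<And>k. k \<in> {1..2*r-1} \<Longrightarrow> d k \<in> S_integers S - {0}"
    and m: "m i \<noteq> 0"
    and dvd2: "\<And>j. j \<in> {1..r-2} \<Longrightarrow> (d (j+1) * d (2*r-j)) divides\<^bsub>\<oo> S\<^esub> (m (j+1) * d j * d (2*r-j-1))"
    and dvd3: "d (r+1) divides\<^bsub>\<oo> S\<^esub> (m r * d (r-1))"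
  shows "lower_m r m d i \<in> S_integers S - {0}"
proof (cases "i = r")
  case True
  have "r + 1 \<in> {1..2*r-1}" "r - 1 \<in> {1..2*r-1}" using r by auto
  note this[THEN d]
  thus ?thesis using dvd3 divides_iff_quotient[of "d (r+1)" "m r * d (r-1)"] True m by (simp add: lower_m_def)
next
  case False
  define j where "j = i - 1"
  have j: "j \<in> {1..r-2}" "j + 1 = i" "j = i - 1" "2*r-j = 2*r-i+1" "2*r-j-1 = 2*r-i"
    using i False by (auto simp: j_def)
  have "i \<in> {1..2*r-1}" "i - 1 \<in> {1..2*r-1}" "2*r-i+1 \<in> {1..2*r-1}" "2*r-i \<in> {1..2*r-1}"
    using i False by auto
  note nz = this[THEN d]
  have "(d i * d (2*r-i+1)) divides\<^bsub>\<oo> S\<^esub> (m i * d (i-1) * d (2*r-i))"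
    using dvd2[OF j(1)] unfolding j(5) unfolding j(2,4) unfolding j(3) .
  moreover have "d i * d (2*r-i+1) \<noteq> 0" using nz by simp
  ultimately have "m i * d (i-1) * d (2*r-i) / (d i * d (2*r-i+1)) \<in> S_integers S"
    using divides_iff_quotient by blast
  thus ?thesis using False m nz by (simp add: lower_m_def)
qed

lemma lower_m_twist: "lower_m r (\<lambda>i. m i * m' i) d i = lower_m r m d i * m' i"
  by (simp add: lower_m_def)

text \<open>Induction on the rank. The term of \<open>(d, D)\<close> contributes the symbols of \<open>m'\<^sub>i\<close> at \<open>frakd\<^sub>i\<close> from the
  sum over \<open>c\<close> and those at \<open>D\<^sub>i\<close> from the coefficient of lower rank; together they are the symbol
  at \<open>C\<^sub>i\<close>, which does not depend on the term.\<close>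

lemma H_coeff_twist:
  assumes "\<And>i. i \<in> {1..Suc k} \<Longrightarrow> C i \<in> S_integers S - {0}"
    and "\<And>i. i \<in> {1..Suc k} \<Longrightarrow> m i \<in> S_integers S - {0}"
    and "\<And>i. i \<in> {1..Suc k} \<Longrightarrow> m' i \<in> S_integers S"
    and "\<And>i j. i \<in> {1..Suc k} \<Longrightarrow> j \<in> {1..Suc k} \<Longrightarrow> coprime_S S (m' i) (C j)"
  shows "(\<Prod>i=1..Suc k. residue_symbol S \<epsilon> n (m' i) (C i) ^ eps (Suc k) i) *
      H_coeff n S \<epsilon> \<psi> R (Suc k) C (\<lambda>i. m i * m' i) = H_coeff n S \<epsilon> \<psi> R (Suc k) C m"
  using assms
proof (induction k arbitrary: C m m')
  case 0
  have "C 1 \<in> S_integers S - {0}" "m 1 \<in> S_integers S" "m' 1 \<in> S_integers S" "coprime_S S (m' 1) (C 1)"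
    using "0.prems"(1)[of 1] "0.prems"(2)[of 1] "0.prems"(3)[of 1] "0.prems"(4)[of 1 1] by auto
  from H_rank_one[OF this] show ?case by (simp add: eps_def)
next
  case (Suc k)
  define r where "r = Suc (Suc k)"
  have r: "r \<ge> 2" "Suc k = r - 1" by (simp_all add: r_def)
  have C: "C i \<in> S_integers S - {0}" if "i \<in> {1..r}" for i using Suc.prems(1) that by (simp add: r_def)
  have m: "m i \<in> S_integers S" "m i \<noteq> 0" if "i \<in> {1..r}" for i using Suc.prems(2)[of i] that by (auto simp: r_def)
  have m': "m' i \<in> S_integers S" if "i \<in> {1..r}" for i using Suc.prems(3) that by (simp add: r_def)
  have cop: "coprime_S S (m' i) (C j)" if "i \<in> {1..r}" "j \<in> {1..r}" for i j
    using Suc.prems(4) that by (simp add: r_def)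
  let ?X = "residue_symbol S \<epsilon> n"
  define J where "J = (\<Prod>i=1..r. ?X (m' i) (C i) ^ eps r i)"
  define P where "P d c = (\<Prod>i=1..r. ?X (c i) (d i) * ?X (c (2*r-i)) (d (2*r-i)))" for d c
  \<comment> \<open>\<open>Q\<close> and \<open>N\<close> collect the Hilbert symbols and the norms, which the twist leaves alone.\<close>
  define Q where "Q d D = (\<Prod>i=1..r-1. \<Prod>j=2*r-i..2*r-1. hilbert_S (2*n) S \<epsilon> (d (2*r-i) / d i) (d j))
          * (\<Prod>i=2..r. hilbert_S (2*n) S \<epsilon> (frakd r d (i-1) / frakd r d i) (D i) powi (- int (eps r i)))"
    for d D
  define N where "N d = (of_nat (ideal_norm S (d r) ^ (2*r-2))
          * (\<Prod>j=1..r-1. of_nat (ideal_norm S (d j ^ (j-1) * d (r+j) ^ (r+j-2)))) :: complex)" for d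
  define T where "T \<mu> d = (\<Sum>c\<in>(\<Pi>\<^sub>E i\<in>{1..2*r-1}. reduced_residues S (d i)).
      P d c * \<psi> (diag S (psi_arg r \<mu> d c (\<lambda>i. inv_mod S (c i) (d i)))))" for \<mu> d
  define L where "L \<mu> d D = H_coeff n S \<epsilon> \<psi> R (Suc k) (\<lambda>i. D (Suc i)) (\<lambda>i. lower_m r \<mu> d (Suc i))" for \<mu> d D
  have H: "H_coeff n S \<epsilon> \<psi> R (Suc (Suc k)) C \<mu> =
      (\<Sum>(d, D)\<in>H_index S R r C \<mu>. T \<mu> d * (Q d D * N d * L \<mu> d D))" for \<mu>
  proof -
    have eq: "T \<mu> d * (Q d D * N d * L \<mu> d D) = (\<Sum>c\<in>(\<Pi>\<^sub>E i\<in>{1..2*r-1}. reduced_residues S (d i)).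
          P d c
          * (\<Prod>i=1..r-1. \<Prod>j=2*r-i..2*r-1. hilbert_S (2*n) S \<epsilon> (d (2*r-i) / d i) (d j))
          * (\<Prod>i=2..r. hilbert_S (2*n) S \<epsilon> (frakd r d (i-1) / frakd r d i) (D i)
                        powi (- int (eps r i)))
          * \<psi> (diag S (psi_arg r \<mu> d c (\<lambda>i. inv_mod S (c i) (d i))))
          * of_nat (ideal_norm S (d r) ^ (2*r-2))
          * (\<Prod>j=1..r-1. of_nat (ideal_norm S (d j ^ (j-1) * d (r+j) ^ (r+j-2))))
          * L \<mu> d D)" for d D
      unfolding T_def Q_def N_def sum_distrib_right by (intro sum.cong refl) (simp only: ac_simps)
    show ?thesis
      unfolding eq unfolding L_def P_def r_def
      by (simp only: H_coeff.simps(2)[of n S \<epsilon> \<psi> R "Suc k"] Let_def nat.distinct(2) if_False)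
  qed
  have index: "H_index S R r C (\<lambda>i. m i * m' i) = H_index S R r C m"
    using r by (intro H_index_twist m m' cop) auto
  have "J * (T (\<lambda>i. m i * m' i) d * (Q d D * N d * L (\<lambda>i. m i * m' i) d D)) =
      T m d * (Q d D * N d * L m d D)" if dD: "(d, D) \<in> H_index S R r C m" for d D
  proof -
    have basic: "d \<in> {1..2*r-1} \<rightarrow>\<^sub>E R" "D \<in> {2..r} \<rightarrow>\<^sub>E R" "C 1 \<sim>\<^bsub>\<oo> S\<^esub> frakd r d 1"
        "\<forall>i\<in>{2..r}. C i \<sim>\<^bsub>\<oo> S\<^esub> frakd r d i * D i"
      and dvd1: "\<And>j. j \<in> {1..r-1} \<Longrightarrow> d (j+1) divides\<^bsub>\<oo> S\<^esub> (m (j+1) * d j)"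
      and dvd2: "\<And>j. j \<in> {1..r-2} \<Longrightarrow> (d (j+1) * d (2*r-j)) divides\<^bsub>\<oo> S\<^esub> (m (j+1) * d j * d (2*r-j-1))"
      and dvd3: "d (r+1) divides\<^bsub>\<oo> S\<^esub> (m r * d (r-1))"
      using dD unfolding H_index_def by blast+
    note facts = H_index_facts[OF r(1) basic]
    have refl_div: "x divides\<^bsub>\<oo> S\<^esub> x" for x by (auto simp: divides_iff intro: bexI[of _ 1])
    have m'd: "coprime_S S (m' i) (d j)" if "i \<in> {1..r}" "j \<in> {1..2*r-1}" for i j
    proof (rule coprime_S_divisors[OF _ refl_div facts(2)[OF that(2)] m'[OF that(1)]])
      show "coprime_S S (m' i) (C 1)" using cop[OF that(1)] r by simp
      show "d j \<in> S_integers S" using facts(1)[OF that(2)] by blast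
    qed
    have T: "T m d = (\<Prod>i=1..r. ?X (m' i) (frakd r d i) ^ eps r i) * T (\<lambda>i. m i * m' i) d"
      unfolding T_def P_def
      by (rule inner_sum_scaled[OF r(1) facts(1) m(1) m' m'd dvd1 dvd2 dvd3])
    have "(\<Prod>i=1..Suc k. ?X (m' (Suc i)) (D (Suc i)) ^ eps (Suc k) i) *
        H_coeff n S \<epsilon> \<psi> R (Suc k) (\<lambda>i. D (Suc i)) (\<lambda>i. lower_m r m d (Suc i) * m' (Suc i)) = L m d D"
      unfolding L_def
    proof (rule Suc.IH)
      fix i assume "i \<in> {1..Suc k}"
      hence i: "Suc i \<in> {2..r}" "Suc i \<in> {1..r}" by (auto simp: r_def)
      show "D (Suc i) \<in> S_integers S - {0}" by (rule facts(3)[OF i(1)])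
      show "m' (Suc i) \<in> S_integers S" by (rule m'[OF i(2)])
      show "lower_m r m d (Suc i) \<in> S_integers S - {0}"
        by (rule lower_m_closed[where m = m, OF r(1) i(1) facts(1) m(2)[OF i(2)] dvd2 dvd3])
      fix j assume "j \<in> {1..Suc k}"
      hence j: "Suc j \<in> {2..r}" "Suc j \<in> {1..r}" by (auto simp: r_def)
      show "coprime_S S (m' (Suc i)) (D (Suc j))"
      proof (rule coprime_S_divisors[OF cop[OF i(2) j(2)] refl_div facts(4)[OF j(1)] m'[OF i(2)]])
        show "D (Suc j) \<in> S_integers S" using facts(3)[OF j(1)] by blast
      qed
    qed
    also have "(\<lambda>i. lower_m r m d (Suc i) * m' (Suc i)) = (\<lambda>i. lower_m r (\<lambda>i. m i * m' i) d (Suc i))"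
      by (simp add: lower_m_twist)
    also have "(\<Prod>i=1..Suc k. ?X (m' (Suc i)) (D (Suc i)) ^ eps (Suc k) i) =
        (\<Prod>i=2..r. ?X (m' i) (D i) ^ eps r i)"
      by (rule prod.reindex_bij_witness[where i = "\<lambda>i. i - 1" and j = Suc]) (auto simp: r_def eps_def)
    finally have L: "L m d D = (\<Prod>i=2..r. ?X (m' i) (D i) ^ eps r i) * L (\<lambda>i. m i * m' i) d D"
      by (simp add: L_def)
    have fr: "frakd r d i \<in> S_integers S - {0}" if "i \<in> {1..r}" for i
      using that by (intro frakd_closed facts(1)) auto
    have split: "{1..r} = insert 1 {2..r}" using r by auto
    have "J = ?X (m' 1) (C 1) ^ eps r 1 * (\<Prod>i=2..r. ?X (m' i) (C i) ^ eps r i)"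
      unfolding J_def split by simp
    also have "?X (m' 1) (C 1) = ?X (m' 1) (frakd r d 1)"
      using r by (intro residue_symbol_associated C fr basic(3)) auto
    also have "(\<Prod>i=2..r. ?X (m' i) (C i) ^ eps r i) =
        (\<Prod>i=2..r. ?X (m' i) (frakd r d i) ^ eps r i * ?X (m' i) (D i) ^ eps r i)"
    proof (rule prod.cong[OF refl])
      fix i assume i: "i \<in> {2..r}"
      have i': "i \<in> {1..r}" using i by simp
      have "frakd r d i * D i \<in> S_integers S - {0}" using fr[OF i'] facts(3)[OF i] by simp
      hence "?X (m' i) (C i) = ?X (m' i) (frakd r d i * D i)"
        using C[OF i'] basic(4) i by (intro residue_symbol_associated) auto
      also have "\<dots> = ?X (m' i) (frakd r d i) * ?X (m' i) (D i)"
        by (rule residue_symbol_mult_bottom[OF fr[OF i'] facts(3)[OF i]])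
      finally show "?X (m' i) (C i) ^ eps r i = ?X (m' i) (frakd r d i) ^ eps r i * ?X (m' i) (D i) ^ eps r i"
        by (simp add: power_mult_distrib)
    qed
    finally have J: "J = (\<Prod>i=1..r. ?X (m' i) (frakd r d i) ^ eps r i) * (\<Prod>i=2..r. ?X (m' i) (D i) ^ eps r i)"
      unfolding split by (simp add: prod.distrib)
    show ?thesis unfolding T L J by (simp only: ac_simps)
  qed
  hence "J * H_coeff n S \<epsilon> \<psi> R (Suc (Suc k)) C (\<lambda>i. m i * m' i) = H_coeff n S \<epsilon> \<psi> R (Suc (Suc k)) C m"
    unfolding H index sum_distrib_left by (intro sum.cong refl) auto
  thus ?case unfolding J_def r_def .
qed

end

theorem theorem2:
  fixes n r :: nat
    and S :: "('a::field_char_0 \<Rightarrow> real) set"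
    and \<epsilon> :: "'a \<Rightarrow> complex"
    and \<psi> :: "(('a \<Rightarrow> real) \<Rightarrow> (nat \<Rightarrow> 'a) set) \<Rightarrow> complex"
    and R :: "'a set"
    and m m' C :: "nat \<Rightarrow> 'a"
  assumes "n \<ge> 1"
    and "number_field TYPE('a)"
    and "card {x::'a. x ^ (4 * n) = 1} = 4 * n"
    and "finite S" and "\<forall>v\<in>S. place v"
    and "\<forall>v\<in>S. \<forall>w\<in>S. same_place v w \<longrightarrow> v = w"
    and "\<forall>v. place v \<and> \<not> nonarch type_ring v \<longrightarrow> (\<exists>w\<in>S. same_place v w)"
    and "\<forall>v. place v \<and> ramified_over_Q v \<longrightarrow> (\<exists>w\<in>S. same_place v w)"
    and "\<forall>v. place v \<and> v (of_nat n) < 1 \<longrightarrow> (\<exists>w\<in>S. same_place v w)"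
    and "principal_domain (\<oo> S)"
    and "\<forall>v. place_outside S v \<longrightarrow> residue_card type_ring v \<ge> 4"
    and "additive_character S \<psi>" and "conductor_S_integers S \<psi>"
    and "unity_embedding (2 * n) \<epsilon>"
    and "unit_representatives S R"
    and "r \<ge> 1"
    and "\<forall>i\<in>{1..r}. m i \<in> S_integers S - {0}"
    and "\<forall>i\<in>{1..r}. m' i \<in> S_integers S - {0}"
    and "\<forall>i\<in>{1..r}. C i \<in> S_integers S - {0}"
    and "coprime_S S (\<Prod>i=1..r. m' i) (\<Prod>i=1..r. C i)"
  shows "H_coeff n S \<epsilon> \<psi> R r C (\<lambda>i. m i * m' i) =
         (\<Prod>i=1..r. residue_symbol S \<epsilon> n (m' i) (C i) powi (- int (eps r i))) * H_coeff n S \<epsilon> \<psi> R r C m"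
proof -
  interpret H_setting S n \<epsilon> \<psi> R
  proof (intro H_setting.intro residue_symbols.intro pid_S_integers.intro
      residue_symbols_axioms.intro H_setting_axioms.intro)
    show "R \<subseteq> S_integers S - {0}" using assms(15) by (simp add: unit_representatives_def)
  qed (fact assms)+
  obtain k where k: "r = Suc k" using assms(16) by (cases r) auto
  have C: "C i \<in> S_integers S - {0}" and m: "m i \<in> S_integers S - {0}" and m': "m' i \<in> S_integers S - {0}"
    if "i \<in> {1..r}" for i
    using assms(17-19) that by blast+
  have cop: "coprime_S S (m' i) (C j)" if "i \<in> {1..r}" "j \<in> {1..r}" for i j
    using C m' that
    by (intro coprime_S_divisors[OF assms(20)] divides_prod) auto
  let ?J = "\<Prod>i=1..r. residue_symbol S \<epsilon> n (m' i) (C i) ^ eps r i"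
  have twist: "?J * H_coeff n S \<epsilon> \<psi> R r C (\<lambda>i. m i * m' i) = H_coeff n S \<epsilon> \<psi> R r C m"
    unfolding k
  proof (rule H_coeff_twist)
    fix i assume "i \<in> {1..Suc k}"
    hence i: "i \<in> {1..r}" by (simp add: k)
    show "C i \<in> S_integers S - {0}" "m i \<in> S_integers S - {0}" "m' i \<in> S_integers S"
      using C[OF i] m[OF i] m'[OF i] by blast+
    fix j assume "j \<in> {1..Suc k}"
    thus "coprime_S S (m' i) (C j)" using i by (intro cop) (simp_all add: k)
  qed
  have "residue_symbol S \<epsilon> n (m' i) (C i) \<noteq> 0" if "i \<in> {1..r}" for i
    using residue_symbol_nonzero[OF cop[OF that that] _ C[OF that]] m'[OF that] by blast
  hence "?J \<noteq> 0" by simp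
  hence "H_coeff n S \<epsilon> \<psi> R r C (\<lambda>i. m i * m' i) = inverse ?J * H_coeff n S \<epsilon> \<psi> R r C m"
    unfolding twist[symmetric] by simp
  also have "inverse ?J = (\<Prod>i=1..r. residue_symbol S \<epsilon> n (m' i) (C i) powi (- int (eps r i)))"
    by (simp add: power_int_minus prod_inversef[symmetric] comp_def)
  finally show ?thesis .
qed

end
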